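(* Let $\gamma>1$, $T>0$, $I=(0,1)$, and let $\rho_0$ be an initial density on $[0,1]$ with $\rho_0(x)>0$ for $0\le x<1$ and $\rho_0(1)=0$. Let $v_1$ and $v_2$ be two solutions on $[0,T]$ of the problem $$\rho_0\left(\frac{x}{r}\right)^2\partial_tv+\partial_x\left[\left(\frac{x^2}{r^2}\,\frac{\rho_0}{\partial_xr}\right)^{\gamma}\right]=0\quad\text{in }I\times(0,T],$$ $$v(0,t)=0\ \text{ for }t\in(0,T],\qquad v(x,0)=u_0(x)\ \text{ for }x\in I,$$ where $r(x,t)=x+\int_0^tv(x,s)\,ds$; correspondingly set $r_i(x,t)=x+\int_0^tv_i(x,s)\,ds$, $i=1,2$. Suppose that there exist positive constants $w_1,w_2,w_3$ such that $$w_1\le\partial_xr_i(x,t)\le w_2\quad\text{and}\quad|\partial_xv_i(x,t)|\le w_3,\qquad (x,t)\in[0,1]\times[0,T],\ i=1,2.$$ If $v_1(x,0)=v_2(x,0)$ for $x\in[0,1]$, then $$v_1(x,t)=v_2(x,t),\qquad (x,t)\in[0,1]\times[0,T].$$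
   Context: The problem is the Lagrangian formulation of the spherically symmetric three-dimensional compressible Euler equations (pressure $p=\rho^\gamma$, no self-gravitation) with vacuum free boundary, the initial domain being the unit ball; $x\in[0,1]$ is the initial radial coordinate, $r(x,t)$ the Lagrangian radial position and $v=\partial_tr$ the velocity. The vacuum boundary is not assumed to be physical, i.e. no condition on $\partial_x(\rho_0^{\gamma-1})$ at $x=1$ is imposed. *)

theory Defs
  imports "HOL-Analysis.Analysis"
begin

text \<open>
  Functions on the rectangle \<open>[0,1] \<times> [0,T]\<close> are curried, with the radial coordinate first.
  The partial derivatives are taken relative to the rectangle, so they are two-sided at interior
  points and one-sided on its edges. They are only meaningful where the function is
  differentiable, which is why differentiability is demanded separately in \<open>euler_solution\<close>.
\<close>

definition partial_x :: "(real \<Rightarrow> real \<Rightarrow> real) \<Rightarrow> real \<Rightarrow> real \<Rightarrow> real" where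
  "partial_x f x t = vector_derivative (\<lambda>y. f y t) (at x within {0..1})"

definition partial_t :: "real \<Rightarrow> (real \<Rightarrow> real \<Rightarrow> real) \<Rightarrow> real \<Rightarrow> real \<Rightarrow> real" where
  "partial_t T f x t = vector_derivative (\<lambda>s. f x s) (at t within {0..T})"

definition radius :: "(real \<Rightarrow> real \<Rightarrow> real) \<Rightarrow> real \<Rightarrow> real \<Rightarrow> real" where
  "radius v x t = x + integral {0..t} (\<lambda>s. v x s)"

definition pressure ::
  "real \<Rightarrow> (real \<Rightarrow> real) \<Rightarrow> (real \<Rightarrow> real \<Rightarrow> real) \<Rightarrow> real \<Rightarrow> real \<Rightarrow> real" where
  "pressure \<gamma> \<rho>\<^sub>0 v x t =
     (x\<^sup>2 / (radius v x t)\<^sup>2 * (\<rho>\<^sub>0 x / partial_x (radius v) x t)) powr \<gamma>"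

text \<open>
  Density profile with vacuum exactly at \<open>x = 1\<close>. Continuity carries the boundary condition: it
  makes the pressure vanish as \<open>x\<close> tends to 1. The decay rate of \<open>\<rho>\<^sub>0\<close> there is unrestricted.
\<close>

definition vacuum_density :: "(real \<Rightarrow> real) \<Rightarrow> bool" where
  "vacuum_density \<rho>\<^sub>0 \<longleftrightarrow>
     continuous_on {0..1} \<rho>\<^sub>0 \<and> (\<forall>x\<in>{0..<1}. \<rho>\<^sub>0 x > 0) \<and> \<rho>\<^sub>0 1 = 0"

text \<open>
  Classical solutions: \<open>v\<close> is continuous on the closed rectangle, \<open>C\<^sup>1\<close> on \<open>(0,1) \<times> (0,T]\<close>, and the
  equation holds pointwise there. On the rest of the closed rectangle only the existence of the
  \<open>x\<close>-derivatives of \<open>v\<close> and \<open>r\<close> is required, with no continuity.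
\<close>

definition euler_solution ::
  "real \<Rightarrow> real \<Rightarrow> (real \<Rightarrow> real) \<Rightarrow> (real \<Rightarrow> real) \<Rightarrow> (real \<Rightarrow> real \<Rightarrow> real) \<Rightarrow> bool" where
  "euler_solution \<gamma> T \<rho>\<^sub>0 u\<^sub>0 v \<longleftrightarrow>
     continuous_on ({0..1} \<times> {0..T}) (\<lambda>(x, t). v x t) \<and>
     (\<forall>x\<in>{0..1}. \<forall>t\<in>{0..T}.
        (\<lambda>y. v y t) differentiable (at x within {0..1}) \<and>
        (\<lambda>y. radius v y t) differentiable (at x within {0..1})) \<and>
     (\<forall>x\<in>{0<..<1}. \<forall>t\<in>{0<..T}.
        (\<lambda>s. v x s) differentiable (at t within {0..T}) \<and>
        (\<lambda>y. pressure \<gamma> \<rho>\<^sub>0 v y t) differentiable (at x within {0..1})) \<and>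
     continuous_on ({0<..<1} \<times> {0<..T}) (\<lambda>(x, t). partial_x v x t) \<and>
     continuous_on ({0<..<1} \<times> {0<..T}) (\<lambda>(x, t). partial_t T v x t) \<and>
     (\<forall>x\<in>{0<..<1}. \<forall>t\<in>{0<..T}.
        \<rho>\<^sub>0 x * (x / radius v x t)\<^sup>2 * partial_t T v x t
          + partial_x (pressure \<gamma> \<rho>\<^sub>0 v) x t = 0) \<and>
     (\<forall>t\<in>{0<..T}. v 0 t = 0) \<and>
     (\<forall>x\<in>{0<..<1}. v x 0 = u\<^sub>0 x)"

end

theory Submission
  imports Defs
begin

text \<open>
  Relative energy method. Put \<open>a = r / x\<close>, \<open>b = \<partial>\<^sub>x r\<close> and \<open>k = \<gamma> - 1\<close>. The internal energy density is
  \<open>\<rho>\<^sub>0 powr \<gamma> * x\<^sup>2 * f a b / k\<close> with \<open>f a b = a powr (- 2 k) * b powr (- k)\<close>, which is strictly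
  convex, uniformly so for \<open>a\<close>, \<open>b\<close> in \<open>[w\<^sub>1, w\<^sub>2]\<close>. The weighted kinetic energy of \<open>v\<^sub>1 - v\<^sub>2\<close> plus
  the first-order Taylor remainder of the internal energy satisfies a balance law whose flux is
  \<open>(v\<^sub>1 - v\<^sub>2) * (r\<^sub>1\<^sup>2 P\<^sub>1 - r\<^sub>2\<^sup>2 P\<^sub>2)\<close>, \<open>P\<^sub>i\<close> being the pressures, and whose source is quadratic in the
  differences of \<open>a\<close> and \<open>b\<close>, hence bounded by the energy itself. The flux is \<open>O(x * \<rho>\<^sub>0 powr \<gamma>)\<close>, so
  it vanishes at the centre and at the vacuum boundary whatever the decay rate of \<open>\<rho>\<^sub>0\<close>, and
  Gronwall's inequality gives uniqueness.
\<close>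

section \<open>Taylor remainders of products of powers\<close>

text \<open>The first-order Taylor remainder of \<open>a powr p * b powr q\<close> at the base point
  \<open>(a\<^sub>0, b\<^sub>0)\<close>. The exponents are free because time differentiation also
  produces remainders with \<open>p - 1\<close> or \<open>q - 1\<close>.\<close>

definition powr_rem :: "real \<Rightarrow> real \<Rightarrow> real \<Rightarrow> real \<Rightarrow> real \<Rightarrow> real \<Rightarrow> real" where
  "powr_rem p q a b a\<^sub>0 b\<^sub>0 = a powr p * b powr q - a\<^sub>0 powr p * b\<^sub>0 powr q
     - (p * a\<^sub>0 powr (p - 1) * b\<^sub>0 powr q * (a - a\<^sub>0) + q * a\<^sub>0 powr p * b\<^sub>0 powr (q - 1) * (b - b\<^sub>0))"

text \<open>Taylor's formula along the segment from the base point. Dividing the increments by the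
  intermediate values leaves a quadratic form whose coefficients depend only on \<open>p\<close> and
  \<open>q\<close>.\<close>

lemma powr_rem_Lagrange:
  fixes m M :: real
  assumes m: "m > 0" and ab: "a \<in> {m..M}" "b \<in> {m..M}" "a\<^sub>0 \<in> {m..M}" "b\<^sub>0 \<in> {m..M}"
  obtains \<alpha> \<beta> where "\<alpha> \<in> {m..M}" "\<beta> \<in> {m..M}"
    "powr_rem p q a b a\<^sub>0 b\<^sub>0 = \<alpha> powr p * \<beta> powr q / 2 *
       (p * (p - 1) * ((a - a\<^sub>0) / \<alpha>)\<^sup>2 + 2 * p * q * ((a - a\<^sub>0) / \<alpha>) * ((b - b\<^sub>0) / \<beta>)
         + q * (q - 1) * ((b - b\<^sub>0) / \<beta>)\<^sup>2)"
proof -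
  define \<alpha> \<beta> where "\<alpha> s = a\<^sub>0 + s * (a - a\<^sub>0)" and "\<beta> s = b\<^sub>0 + s * (b - b\<^sub>0)" for s
  have seg: "c\<^sub>0 + s * (c - c\<^sub>0) \<in> {m..M}" if "0 \<le> s" "s \<le> 1" "c \<in> {m..M}" "c\<^sub>0 \<in> {m..M}" for s c c\<^sub>0
    using convexD_alt[of "{m..M}" c\<^sub>0 c s] that by (simp add: algebra_simps)
  have in_box: "\<alpha> s \<in> {m..M}" "\<beta> s \<in> {m..M}" if "0 \<le> s" "s \<le> 1" for s
    using seg[OF that] ab by (auto simp: \<alpha>_def \<beta>_def simp del: atLeastAtMost_iff)
  have pos: "\<alpha> s > 0" "\<beta> s > 0" if "0 \<le> s" "s \<le> 1" for s
    using in_box[OF that] m by auto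
  \<comment> \<open>For \<open>n \<le> 2\<close> this is the n-th derivative along the segment;
    larger \<open>n\<close> repeat the second one and never enter the order-two expansion.\<close>
  define \<phi> where "\<phi> n s = (if n = (0::nat) then \<alpha> s powr p * \<beta> s powr q
      else if n = 1 then p * (a - a\<^sub>0) * (\<alpha> s powr (p - 1) * \<beta> s powr q)
        + q * (b - b\<^sub>0) * (\<alpha> s powr p * \<beta> s powr (q - 1))
      else p * (p - 1) * (a - a\<^sub>0)\<^sup>2 * (\<alpha> s powr (p - 2) * \<beta> s powr q)
        + 2 * p * q * (a - a\<^sub>0) * (b - b\<^sub>0) * (\<alpha> s powr (p - 1) * \<beta> s powr (q - 1))
        + q * (q - 1) * (b - b\<^sub>0)\<^sup>2 * (\<alpha> s powr p * \<beta> s powr (q - 2)))" for n s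
  have D\<alpha>: "((\<lambda>s. \<alpha> s powr r) has_real_derivative r * (a - a\<^sub>0) * \<alpha> s powr (r - 1)) (at s)"
    if "0 \<le> s" "s \<le> 1" for r s
    using pos[OF that] unfolding \<alpha>_def by (auto intro!: derivative_eq_intros simp: field_simps)
  have D\<beta>: "((\<lambda>s. \<beta> s powr r) has_real_derivative r * (b - b\<^sub>0) * \<beta> s powr (r - 1)) (at s)"
    if "0 \<le> s" "s \<le> 1" for r s
    using pos[OF that] unfolding \<beta>_def by (auto intro!: derivative_eq_intros simp: field_simps)
  have two: "r - 1 - 1 = r - 2" for r :: real by simp
  have "DERIV (\<phi> n) s :> \<phi> (Suc n) s" if "n < 2" "0 \<le> s" "s \<le> 1" for n s
  proof -
    note D = D\<alpha>[OF that(2,3)] D\<beta>[OF that(2,3)]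
    consider "n = 0" | "n = 1" using \<open>n < 2\<close> by linarith
    then show ?thesis
    proof cases
      case 1
      have "DERIV (\<lambda>s. \<alpha> s powr p * \<beta> s powr q) s :> \<phi> 1 s"
        unfolding \<phi>_def by (rule DERIV_cong, (rule D DERIV_cmult DERIV_mult DERIV_add)+) (simp add: algebra_simps)
      moreover have "\<phi> 0 = (\<lambda>s. \<alpha> s powr p * \<beta> s powr q)"
        by (simp add: \<phi>_def fun_eq_iff)
      ultimately show ?thesis unfolding 1 One_nat_def by metis
    next
      case 2
      have "DERIV (\<lambda>s. p * (a - a\<^sub>0) * (\<alpha> s powr (p - 1) * \<beta> s powr q)
          + q * (b - b\<^sub>0) * (\<alpha> s powr p * \<beta> s powr (q - 1))) s :> \<phi> 2 s"
        unfolding \<phi>_def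
        by (rule DERIV_cong, (rule D DERIV_cmult DERIV_mult DERIV_add)+) (simp add: two power2_eq_square algebra_simps)
      moreover have "\<phi> 1 = (\<lambda>s. p * (a - a\<^sub>0) * (\<alpha> s powr (p - 1) * \<beta> s powr q)
          + q * (b - b\<^sub>0) * (\<alpha> s powr p * \<beta> s powr (q - 1)))"
        by (simp add: \<phi>_def fun_eq_iff)
      ultimately show ?thesis unfolding 2 Suc_1 by metis
    qed
  qed
  then obtain s where s: "0 < s" "s < 1"
    "\<phi> 0 1 = (\<Sum>n<2. \<phi> n 0 / fact n * 1 ^ n) + \<phi> 2 s / fact 2 * 1 ^ 2"
    using Maclaurin[of 1 2 \<phi> "\<phi> 0"] by auto
  have sp: "\<alpha> s > 0" "\<beta> s > 0" using pos s by auto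
  have two_terms: "(\<Sum>n<2. g n) = g 0 + g 1" for g :: "nat \<Rightarrow> real"
    by (simp add: numeral_2_eq_2)
  have "powr_rem p q a b a\<^sub>0 b\<^sub>0 = \<phi> 2 s / 2"
    using s(3) unfolding two_terms
    by (simp add: \<phi>_def \<alpha>_def \<beta>_def powr_rem_def algebra_simps)
  also have "\<phi> 2 s / 2 = \<alpha> s powr p * \<beta> s powr q / 2 *
       (p * (p - 1) * ((a - a\<^sub>0) / \<alpha> s)\<^sup>2 + 2 * p * q * ((a - a\<^sub>0) / \<alpha> s) * ((b - b\<^sub>0) / \<beta> s)
         + q * (q - 1) * ((b - b\<^sub>0) / \<beta> s)\<^sup>2)"
    using sp by (simp add: \<phi>_def powr_diff powr_numeral power_divide field_simps)
  finally show thesis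
    using that[of "\<alpha> s" "\<beta> s"] in_box[of s] s by auto
qed

text \<open>A power is monotone, in the direction given by the sign of \<open>p\<close>, so its
  extremes lie at the endpoints; \<open>min\<close> and \<open>max\<close> cover both
  directions.\<close>

lemma powr_bounds:
  fixes m M p :: real
  assumes "m > 0" and "m \<le> M"
  obtains l u where "l > 0" and "\<And>a. a \<in> {m..M} \<Longrightarrow> l \<le> a powr p \<and> a powr p \<le> u"
proof
  show "min (m powr p) (M powr p) > 0" using assms by auto
  fix a assume "a \<in> {m..M}"
  with \<open>m > 0\<close> show "min (m powr p) (M powr p) \<le> a powr p \<and> a powr p \<le> max (m powr p) (M powr p)"
    by (cases "p \<ge> 0") (auto intro: powr_mono2 powr_mono2' simp: le_max_iff_disj min_le_iff_disj)
qed

text \<open>In the Lagrange form the powers are bounded, the cross term is absorbed by the two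
  squares, and the intermediate values are at least \<open>m\<close>.\<close>

lemma powr_rem_upper:
  fixes m M :: real
  assumes "m > 0" and "m \<le> M"
  obtains C where "C > 0" and "\<And>a b a\<^sub>0 b\<^sub>0. {a, b, a\<^sub>0, b\<^sub>0} \<subseteq> {m..M} \<Longrightarrow>
    \<bar>powr_rem p q a b a\<^sub>0 b\<^sub>0\<bar> \<le> C * ((a - a\<^sub>0)\<^sup>2 + (b - b\<^sub>0)\<^sup>2)"
proof -
  obtain l u where lu: "l > 0" "\<And>a. a \<in> {m..M} \<Longrightarrow> l \<le> a powr p \<and> a powr p \<le> u"
    using powr_bounds[OF assms] by blast
  obtain l' u' where lu': "l' > 0" "\<And>a. a \<in> {m..M} \<Longrightarrow> l' \<le> a powr q \<and> a powr q \<le> u'"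
    using powr_bounds[OF assms] by blast
  define K where "K = \<bar>p * (p - 1)\<bar> + \<bar>p * q\<bar> + \<bar>q * (q - 1)\<bar>"
  have u: "u > 0" "u' > 0" using lu(1) lu(2)[of m] lu'(1) lu'(2)[of m] assms by auto
  have K: "K \<ge> 0" by (simp add: K_def)
  show thesis
  \<comment> \<open>The summand 1 keeps the constant positive when \<open>K = 0\<close>.\<close>
  proof (rule that[of "u * u' / 2 * K / m\<^sup>2 + 1"])
    show "u * u' / 2 * K / m\<^sup>2 + 1 > 0" using u K assms by (simp add: add_nonneg_pos)
    fix a b a\<^sub>0 b\<^sub>0 assume "{a, b, a\<^sub>0, b\<^sub>0} \<subseteq> {m..M}"
    then obtain \<alpha> \<beta> where ab: "\<alpha> \<in> {m..M}" "\<beta> \<in> {m..M}"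
      and eq: "powr_rem p q a b a\<^sub>0 b\<^sub>0 = \<alpha> powr p * \<beta> powr q / 2 *
       (p * (p - 1) * ((a - a\<^sub>0) / \<alpha>)\<^sup>2 + 2 * p * q * ((a - a\<^sub>0) / \<alpha>) * ((b - b\<^sub>0) / \<beta>)
         + q * (q - 1) * ((b - b\<^sub>0) / \<beta>)\<^sup>2)"
      using powr_rem_Lagrange[OF \<open>m > 0\<close>, of a M b a\<^sub>0 b\<^sub>0 p q] by auto
    define X Y where "X = (a - a\<^sub>0) / \<alpha>" and "Y = (b - b\<^sub>0) / \<beta>"
    have XY: "2 * \<bar>X * Y\<bar> \<le> X\<^sup>2 + Y\<^sup>2"
      using sum_squares_bound[of X Y] sum_squares_bound[of "-X" Y] by (auto simp: abs_if)
    have "\<bar>p * (p - 1) * X\<^sup>2 + 2 * p * q * X * Y + q * (q - 1) * Y\<^sup>2\<bar>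
        \<le> \<bar>p * (p - 1)\<bar> * X\<^sup>2 + \<bar>p * q\<bar> * (2 * \<bar>X * Y\<bar>) + \<bar>q * (q - 1)\<bar> * Y\<^sup>2"
    proof -
      have "\<bar>p * (p - 1) * X\<^sup>2 + 2 * p * q * X * Y + q * (q - 1) * Y\<^sup>2\<bar>
        \<le> \<bar>p * (p - 1) * X\<^sup>2\<bar> + \<bar>2 * p * q * X * Y\<bar> + \<bar>q * (q - 1) * Y\<^sup>2\<bar>" by linarith
      then show ?thesis by (simp only: abs_mult abs_power2 abs_numeral mult_ac)
    qed
    also have "\<dots> \<le> \<bar>p * (p - 1)\<bar> * (X\<^sup>2 + Y\<^sup>2) + \<bar>p * q\<bar> * (X\<^sup>2 + Y\<^sup>2) + \<bar>q * (q - 1)\<bar> * (X\<^sup>2 + Y\<^sup>2)"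
      by (intro add_mono mult_left_mono XY) auto
    also have "\<dots> = K * (X\<^sup>2 + Y\<^sup>2)" by (simp add: K_def algebra_simps)
    also have "\<dots> \<le> K * (((a - a\<^sub>0)\<^sup>2 + (b - b\<^sub>0)\<^sup>2) / m\<^sup>2)"
      using ab \<open>m > 0\<close> K unfolding X_def Y_def power_divide add_divide_distrib
      by (intro mult_left_mono add_mono divide_left_mono power_mono) auto
    finally have "\<bar>p * (p - 1) * X\<^sup>2 + 2 * p * q * X * Y + q * (q - 1) * Y\<^sup>2\<bar>
      \<le> K * (((a - a\<^sub>0)\<^sup>2 + (b - b\<^sub>0)\<^sup>2) / m\<^sup>2)" .
    moreover have "\<alpha> powr p * \<beta> powr q / 2 \<le> u * u' / 2"
      using lu(2)[OF ab(1)] lu'(2)[OF ab(2)] u by (simp add: mult_mono)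
    ultimately have "\<bar>powr_rem p q a b a\<^sub>0 b\<^sub>0\<bar> \<le> u * u' / 2 * (K * (((a - a\<^sub>0)\<^sup>2 + (b - b\<^sub>0)\<^sup>2) / m\<^sup>2))"
      unfolding eq abs_mult X_def[symmetric] Y_def[symmetric]
      using u by (intro mult_mono) auto
    also have "\<dots> = u * u' / 2 * K / m\<^sup>2 * ((a - a\<^sub>0)\<^sup>2 + (b - b\<^sub>0)\<^sup>2)" by simp
    also have "\<dots> \<le> (u * u' / 2 * K / m\<^sup>2 + 1) * ((a - a\<^sub>0)\<^sup>2 + (b - b\<^sub>0)\<^sup>2)"
      by (intro mult_right_mono) auto
    finally show "\<bar>powr_rem p q a b a\<^sub>0 b\<^sub>0\<bar> \<le> (u * u' / 2 * K / m\<^sup>2 + 1) * ((a - a\<^sub>0)\<^sup>2 + (b - b\<^sub>0)\<^sup>2)" .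
  qed
qed

text \<open>Uniform convexity: for these exponents the Lagrange quadratic form equals
  \<open>k\<^sup>2 * (2 * X + Y)\<^sup>2 + 2 * k * X\<^sup>2 + k * Y\<^sup>2\<close>, which is at
  least \<open>k * (X\<^sup>2 + Y\<^sup>2)\<close>, and the intermediate values are at most
  \<open>M\<close>.\<close>

lemma powr_rem_lower:
  fixes m M k :: real
  assumes "m > 0" and "m \<le> M" and "k > 0"
  obtains c where "c > 0" and "\<And>a b a\<^sub>0 b\<^sub>0. {a, b, a\<^sub>0, b\<^sub>0} \<subseteq> {m..M} \<Longrightarrow>
    c * ((a - a\<^sub>0)\<^sup>2 + (b - b\<^sub>0)\<^sup>2) \<le> powr_rem (- 2 * k) (- k) a b a\<^sub>0 b\<^sub>0"
proof -
  obtain l u where lu: "l > 0" "\<And>a. a \<in> {m..M} \<Longrightarrow> l \<le> a powr (- 2 * k) \<and> a powr (- 2 * k) \<le> u"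
    using powr_bounds[OF assms(1,2)] by blast
  obtain l' u' where lu': "l' > 0" "\<And>a. a \<in> {m..M} \<Longrightarrow> l' \<le> a powr (- k) \<and> a powr (- k) \<le> u'"
    using powr_bounds[OF assms(1,2)] by blast
  show thesis
  proof (rule that[of "l * l' / 2 * k / M\<^sup>2"])
    show "l * l' / 2 * k / M\<^sup>2 > 0" using lu(1) lu'(1) assms by simp
    fix a b a\<^sub>0 b\<^sub>0 assume "{a, b, a\<^sub>0, b\<^sub>0} \<subseteq> {m..M}"
    then obtain \<alpha> \<beta> where ab: "\<alpha> \<in> {m..M}" "\<beta> \<in> {m..M}"
      and eq: "powr_rem (- 2 * k) (- k) a b a\<^sub>0 b\<^sub>0 = \<alpha> powr (- 2 * k) * \<beta> powr (- k) / 2 *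
       ((- 2 * k) * ((- 2 * k) - 1) * ((a - a\<^sub>0) / \<alpha>)\<^sup>2
         + 2 * (- 2 * k) * (- k) * ((a - a\<^sub>0) / \<alpha>) * ((b - b\<^sub>0) / \<beta>)
         + (- k) * ((- k) - 1) * ((b - b\<^sub>0) / \<beta>)\<^sup>2)"
      using powr_rem_Lagrange[OF \<open>m > 0\<close>, of a M b a\<^sub>0 b\<^sub>0 "-2*k" "-k"] by auto
    define X Y where "X = (a - a\<^sub>0) / \<alpha>" and "Y = (b - b\<^sub>0) / \<beta>"
    have "k * (((a - a\<^sub>0)\<^sup>2 + (b - b\<^sub>0)\<^sup>2) / M\<^sup>2) \<le> k * (X\<^sup>2 + Y\<^sup>2)"
      using ab assms unfolding X_def Y_def power_divide add_divide_distrib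
      by (intro mult_left_mono add_mono divide_left_mono power_mono mult_pos_pos) auto
    also have "\<dots> \<le> k\<^sup>2 * (2 * X + Y)\<^sup>2 + 2 * k * X\<^sup>2 + k * Y\<^sup>2"
    proof -
      have "0 \<le> k\<^sup>2 * (2 * X + Y)\<^sup>2" "0 \<le> k * X\<^sup>2" using assms by auto
      then show ?thesis by (simp add: algebra_simps)
    qed
    also have "\<dots> = (- 2 * k) * ((- 2 * k) - 1) * X\<^sup>2
         + 2 * (- 2 * k) * (- k) * X * Y + (- k) * ((- k) - 1) * Y\<^sup>2"
      by (simp add: power2_eq_square algebra_simps)
    finally have *: "k * (((a - a\<^sub>0)\<^sup>2 + (b - b\<^sub>0)\<^sup>2) / M\<^sup>2) \<le> \<dots>" .
    have "l * l' / 2 * k / M\<^sup>2 * ((a - a\<^sub>0)\<^sup>2 + (b - b\<^sub>0)\<^sup>2)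
        = l * l' / 2 * (k * (((a - a\<^sub>0)\<^sup>2 + (b - b\<^sub>0)\<^sup>2) / M\<^sup>2))" by simp
    also have "\<dots> \<le> powr_rem (- 2 * k) (- k) a b a\<^sub>0 b\<^sub>0"
      unfolding eq X_def[symmetric] Y_def[symmetric]
      using lu(1) lu(2)[OF ab(1)] lu'(1) lu'(2)[OF ab(2)] assms
      by (intro mult_mono * divide_right_mono) auto
    finally show "l * l' / 2 * k / M\<^sup>2 * ((a - a\<^sub>0)\<^sup>2 + (b - b\<^sub>0)\<^sup>2)
      \<le> powr_rem (- 2 * k) (- k) a b a\<^sub>0 b\<^sub>0" .
  qed
qed

text \<open>The grouping matters: \<open>a' - a\<^sub>0'\<close> and \<open>b' - b\<^sub>0'\<close>
  multiply differences of partial derivatives, which will cancel against the flux, while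
  \<open>a\<^sub>0'\<close> and \<open>b\<^sub>0'\<close> multiply Taylor remainders of these
  partial derivatives, which are quadratically small.\<close>

lemma DERIV_powr_rem:
  fixes a b a\<^sub>0 b\<^sub>0 :: "real \<Rightarrow> real"
  assumes d: "DERIV a t :> a'" "DERIV b t :> b'" "DERIV a\<^sub>0 t :> a\<^sub>0'" "DERIV b\<^sub>0 t :> b\<^sub>0'"
    and pos: "a t > 0" "b t > 0" "a\<^sub>0 t > 0" "b\<^sub>0 t > 0"
  shows "DERIV (\<lambda>t. powr_rem p q (a t) (b t) (a\<^sub>0 t) (b\<^sub>0 t)) t :>
    p * (a t powr (p - 1) * b t powr q - a\<^sub>0 t powr (p - 1) * b\<^sub>0 t powr q) * (a' - a\<^sub>0')
    + q * (a t powr p * b t powr (q - 1) - a\<^sub>0 t powr p * b\<^sub>0 t powr (q - 1)) * (b' - b\<^sub>0')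
    + p * powr_rem (p - 1) q (a t) (b t) (a\<^sub>0 t) (b\<^sub>0 t) * a\<^sub>0'
    + q * powr_rem p (q - 1) (a t) (b t) (a\<^sub>0 t) (b\<^sub>0 t) * b\<^sub>0'"
proof -
  have dp: "DERIV (\<lambda>t. c t powr r) t :> r * c t powr (r - 1) * c'" if "DERIV c t :> c'" "c t > 0"
    for c :: "real \<Rightarrow> real" and c' r
    using DERIV_fun_powr[OF that] by simp
  show ?thesis
    unfolding powr_rem_def
    by (rule derivative_eq_intros dp d pos refl)+ (simp add: algebra_simps)
qed

section \<open>Regularity of a single flow\<close>

text \<open>The bound on the difference quotients passes to their limit. This will turn a Lipschitz
  estimate in \<open>x\<close> for time increments of the radius into an estimate for time
  increments of its gradient.\<close>

lemma DERIV_within_le_Lipschitz: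
  fixes f :: "real \<Rightarrow> real"
  assumes der: "(f has_real_derivative D) (at x within S)" and nt: "at x within S \<noteq> bot"
    and lip: "\<And>y. y \<in> S \<Longrightarrow> \<bar>f y - f x\<bar> \<le> L * \<bar>y - x\<bar>"
  shows "\<bar>D\<bar> \<le> L"
proof (rule tendsto_upperbound[OF _ _ nt])
  show "((\<lambda>y. \<bar>(f y - f x) / (y - x)\<bar>) \<longlongrightarrow> \<bar>D\<bar>) (at x within S)"
    using der unfolding has_field_derivative_iff by (rule tendsto_rabs)
  show "\<forall>\<^sub>F y in at x within S. \<bar>(f y - f x) / (y - x)\<bar> \<le> L"
    unfolding eventually_at_filter using lip
    by (intro always_eventually) (auto simp: abs_divide divide_le_eq)
qed

text \<open>Since \<open>L\<close> does not depend on \<open>x\<close>, continuity in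
  \<open>x\<close> at each fixed time becomes joint continuity. It serves for the radius and its
  gradient.\<close>

lemma continuous_on_Times_Lipschitz:
  fixes f :: "real \<Rightarrow> real \<Rightarrow> real"
  assumes cont: "\<And>t. t \<in> B \<Longrightarrow> continuous_on A (\<lambda>x. f x t)"
    and lip: "\<And>x s t. x \<in> A \<Longrightarrow> s \<in> B \<Longrightarrow> t \<in> B \<Longrightarrow> \<bar>f x s - f x t\<bar> \<le> L * \<bar>s - t\<bar>"
    and "L \<ge> 0"
  shows "continuous_on (A \<times> B) (\<lambda>(x, t). f x t)"
proof (rule Lipschitz.continuous_on_TimesI)
  show "local_lipschitz A B f"
    using lip \<open>L \<ge> 0\<close>
    by (intro local_lipschitzI exI[of _ 1] exI[of _ L] conjI ballI lipschitz_onI) (auto simp: dist_real_def)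
qed (rule cont)

lemma continuous_on_Times_slices:
  fixes f :: "real \<Rightarrow> real \<Rightarrow> real"
  assumes "continuous_on (A \<times> B) (\<lambda>(x, t). f x t)"
  shows continuous_on_slice_snd: "x \<in> A \<Longrightarrow> S \<subseteq> B \<Longrightarrow> continuous_on S (\<lambda>t. f x t)"
    and continuous_on_slice_fst: "t \<in> B \<Longrightarrow> R \<subseteq> A \<Longrightarrow> continuous_on R (\<lambda>x. f x t)"
proof -
  have c: "continuous_on S (\<lambda>t. (x, t))" "continuous_on R (\<lambda>x. (x, t))"
    by (intro continuous_intros)+
  show "x \<in> A \<Longrightarrow> S \<subseteq> B \<Longrightarrow> continuous_on S (\<lambda>t. f x t)"
    using continuous_on_compose2[OF assms c(1)] by fastforce
  show "t \<in> B \<Longrightarrow> R \<subseteq> A \<Longrightarrow> continuous_on R (\<lambda>x. f x t)"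
    using continuous_on_compose2[OF assms c(2)] by fastforce
qed

lemma partial_x_eqI:
  assumes "((\<lambda>y. f y t) has_real_derivative D) (at x within {0..1})" and "x \<in> {0..1}"
  shows "partial_x f x t = D"
  unfolding partial_x_def
  using assms by (intro vector_derivative_within_closed_interval)
    (auto simp: has_real_derivative_iff_has_vector_derivative)

lemma has_real_derivative_partial_x:
  assumes "(\<lambda>y. f y t) differentiable (at x within {0..1})"
  shows "((\<lambda>y. f y t) has_real_derivative partial_x f x t) (at x within {0..1})"
  using assms unfolding partial_x_def
  by (simp add: has_real_derivative_iff_has_vector_derivative vector_derivative_works[symmetric])

lemma at_within_unit_interval: "at x within {0..1} = at x" if "x \<in> {0<..<1}" for x :: real
  using that by (simp add: at_within_Icc_at)

text \<open>Collects the hypotheses on one solution, so that its regularity is proved once and then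
  instantiated for both flows.\<close>

locale bounded_flow =
  fixes \<gamma> T w\<^sub>1 w\<^sub>2 w\<^sub>3 :: real and \<rho> u\<^sub>0 :: "real \<Rightarrow> real" and v :: "real \<Rightarrow> real \<Rightarrow> real"
  assumes gamma: "\<gamma> > 1" and T: "T > 0" and density: "vacuum_density \<rho>"
    and sol: "euler_solution \<gamma> T \<rho> u\<^sub>0 v"
    and w_pos: "w\<^sub>1 > 0" "w\<^sub>2 > 0" "w\<^sub>3 > 0"
    and bounds: "\<And>x t. x \<in> {0..1} \<Longrightarrow> t \<in> {0..T} \<Longrightarrow>
      w\<^sub>1 \<le> partial_x (radius v) x t \<and> partial_x (radius v) x t \<le> w\<^sub>2 \<and> \<bar>partial_x v x t\<bar> \<le> w\<^sub>3"
begin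

abbreviation r where "r \<equiv> radius v"
abbreviation r_x where "r_x \<equiv> partial_x (radius v)"
abbreviation v_x where "v_x \<equiv> partial_x v"
abbreviation v_t where "v_t \<equiv> partial_t T v"

lemma w_le: "w\<^sub>1 \<le> w\<^sub>2"
  using bounds[of 0 0] T by auto

lemma continuous_v: "continuous_on ({0..1} \<times> {0..T}) (\<lambda>(x, t). v x t)"
  and continuous_v_x: "continuous_on ({0<..<1} \<times> {0<..T}) (\<lambda>(x, t). v_x x t)"
  and continuous_v_t: "continuous_on ({0<..<1} \<times> {0<..T}) (\<lambda>(x, t). v_t x t)"
  using sol by (auto simp: euler_solution_def)

lemma continuous_v_time:
  assumes "x \<in> {0..1}" and "S \<subseteq> {0..T}"
  shows "continuous_on S (v x)"
  using continuous_on_slice_snd[OF continuous_v] assms by simp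

lemma DERIV_v_x:
  "x \<in> {0..1} \<Longrightarrow> t \<in> {0..T} \<Longrightarrow> ((\<lambda>y. v y t) has_real_derivative v_x x t) (at x within {0..1})"
  and DERIV_r_x:
  "x \<in> {0..1} \<Longrightarrow> t \<in> {0..T} \<Longrightarrow> ((\<lambda>y. r y t) has_real_derivative r_x x t) (at x within {0..1})"
  using sol by (auto simp: euler_solution_def intro: has_real_derivative_partial_x)

text \<open>The boundary condition is imposed only for positive times; continuity in time extends it
  to \<open>t = 0\<close>.\<close>

lemma v_center: "t \<in> {0..T} \<Longrightarrow> v 0 t = 0"
proof -
  assume t: "t \<in> {0..T}"
  have "closure {0<..<T} = {0..T}" using T by simp
  moreover have "continuous_on (closure {0<..<T}) (v 0)"
    using T by (intro continuous_v_time) auto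
  moreover have "v 0 s = 0" if "s \<in> {0<..<T}" for s
    using sol that by (auto simp: euler_solution_def)
  ultimately show "v 0 t = 0"
    using continuous_constant_on_closure[of "{0<..<T}" "v 0" 0 t] t by auto
qed

section \<open>Spatial Lipschitz bound and bounds on the stretch \<open>r / x\<close>\<close>

lemma v_Lipschitz:
  assumes "x \<in> {0..1}" "y \<in> {0..1}" "t \<in> {0..T}"
  shows "\<bar>v y t - v x t\<bar> \<le> w\<^sub>3 * \<bar>y - x\<bar>"
  using field_differentiable_bound[of "{0..1}" "\<lambda>y. v y t" "\<lambda>y. v_x y t" w\<^sub>3 y x]
    DERIV_v_x bounds assms by auto

text \<open>The Lipschitz bound is applied from the centre, where \<open>v\<close> vanishes. The
  factor \<open>x\<close> keeps \<open>v / x\<close> bounded and makes the flux vanish at the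
  centre.\<close>

lemma v_bound: "x \<in> {0..1} \<Longrightarrow> t \<in> {0..T} \<Longrightarrow> \<bar>v x t\<bar> \<le> w\<^sub>3 * x"
  using v_Lipschitz[of 0 x t] v_center[of t] by simp

lemma r_center: "t \<in> {0..T} \<Longrightarrow> r 0 t = 0"
proof -
  assume t: "t \<in> {0..T}"
  have "integral {0..t} (v 0) = integral {0..t} (\<lambda>_. 0)"
    using t v_center by (intro integral_cong) auto
  then show ?thesis by (simp add: radius_def)
qed

text \<open>The mean value theorem between the centre, where \<open>r\<close> vanishes, and
  \<open>x\<close> transfers the bounds on \<open>r_x\<close> to \<open>r / x\<close>.\<close>

lemma r_bounds:
  assumes "x \<in> {0..1}" "t \<in> {0..T}"
  shows "w\<^sub>1 * x \<le> r x t \<and> r x t \<le> w\<^sub>2 * x"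
proof -
  have "\<exists>z\<in>{0..x}. r x t - r 0 t = r_x z t * (x - 0)"
  proof (rule mvt_very_simple)
    fix z assume "0 \<le> z" "z \<le> x"
    then show "((\<lambda>y. r y t) has_derivative (*) (r_x z t)) (at z within {0..x})"
      using has_field_derivative_subset[OF DERIV_r_x[of z t], of "{0..x}"] assms
      by (auto simp: has_field_derivative_def)
  qed (use assms in auto)
  then obtain z where z: "z \<in> {0..x}" "r x t = r_x z t * x"
    using r_center[OF assms(2)] by auto
  then show ?thesis using bounds[of z t] assms by (auto intro: mult_right_mono)
qed

lemma stretch_bounds:
  assumes "x \<in> {0<..1}" "t \<in> {0..T}"
  shows "r x t / x \<in> {w\<^sub>1..w\<^sub>2}"
  using r_bounds[of x t] assms by (auto simp: field_simps)

lemma r_pos: "x \<in> {0<..1} \<Longrightarrow> t \<in> {0..T} \<Longrightarrow> r x t > 0"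
  using r_bounds[of x t] w_pos(1) by (smt (verit) atLeastAtMost_iff greaterThanAtMost_iff mult_pos_pos)

lemma r_x_pos: "x \<in> {0..1} \<Longrightarrow> t \<in> {0..T} \<Longrightarrow> r_x x t > 0"
  using bounds[of x t] w_pos by auto

section \<open>Time dependence of the radius and of its gradient\<close>

lemma r_increment:
  assumes "x \<in> {0..1}" "0 \<le> s" "s \<le> t" "t \<le> T"
  shows "r x t - r x s = integral {s..t} (v x)"
proof -
  have "continuous_on {0..t} (v x)"
    using assms by (intro continuous_v_time) auto
  then show ?thesis
    using Henstock_Kurzweil_Integration.integral_combine[of 0 s t "v x"] assms
    by (simp add: radius_def integrable_continuous_interval)
qed

lemma r_Lipschitz_time:
  assumes "x \<in> {0..1}" "s \<in> {0..T}" "t \<in> {0..T}"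
  shows "\<bar>r x s - r x t\<bar> \<le> w\<^sub>3 * \<bar>s - t\<bar>"
proof -
  have *: "\<bar>r x t - r x s\<bar> \<le> w\<^sub>3 * (t - s)" if "0 \<le> s" "s \<le> t" "t \<le> T" for s t
  proof -
    have "norm (v x \<tau>) \<le> w\<^sub>3" if "\<tau> \<in> {s..t}" for \<tau>
    proof -
      have "\<bar>v x \<tau>\<bar> \<le> w\<^sub>3 * x" using v_bound that assms \<open>0 \<le> s\<close> \<open>t \<le> T\<close> by auto
      also have "\<dots> \<le> w\<^sub>3" using assms w_pos by auto
      finally show ?thesis by simp
    qed
    moreover have "continuous_on {s..t} (v x)"
      using assms that by (intro continuous_v_time) auto
    ultimately show ?thesis
      using r_increment[OF assms(1) that] integral_bound[of s t "v x" w\<^sub>3] that by simp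
  qed
  show ?thesis using *[of s t] *[of t s] assms by (cases "s \<le> t") auto
qed

text \<open>The increment of \<open>r\<close> over \<open>[s, t]\<close> is the time integral of
  \<open>v\<close>, hence Lipschitz in \<open>x\<close> with constant
  \<open>w\<^sub>3 * (t - s)\<close>, and its \<open>x\<close>-derivative inherits this bound. The
  argument works on the whole closed rectangle, where \<open>v_x\<close> is not known to be
  continuous.\<close>

lemma r_x_Lipschitz_time:
  assumes "x \<in> {0..1}" "s \<in> {0..T}" "t \<in> {0..T}"
  shows "\<bar>r_x x s - r_x x t\<bar> \<le> w\<^sub>3 * \<bar>s - t\<bar>"
proof -
  have *: "\<bar>r_x x t - r_x x s\<bar> \<le> w\<^sub>3 * (t - s)" if st: "0 \<le> s" "s \<le> t" "t \<le> T" for s t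
  proof (rule DERIV_within_le_Lipschitz)
    show "((\<lambda>y. r y t - r y s) has_real_derivative r_x x t - r_x x s) (at x within {0..1})"
      using st assms by (intro DERIV_diff DERIV_r_x) auto
    show "at x within {0..1} \<noteq> bot"
      using assms by (simp add: trivial_limit_within islimpt_Icc)
    fix y :: real assume y: "y \<in> {0..1}"
    have c: "continuous_on {s..t} (v x)" "continuous_on {s..t} (v y)"
      using assms(1) y st by (auto intro!: continuous_v_time)
    have "(r y t - r y s) - (r x t - r x s) = integral {s..t} (\<lambda>\<tau>. v y \<tau> - v x \<tau>)"
      using r_increment[OF y st] r_increment[OF assms(1) st] c
      by (simp add: integral_diff integrable_continuous_interval)
    also have "\<bar>\<dots>\<bar> \<le> w\<^sub>3 * \<bar>y - x\<bar> * (t - s)"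
      using integral_bound[of s t "\<lambda>\<tau>. v y \<tau> - v x \<tau>" "w\<^sub>3 * \<bar>y - x\<bar>"] c st v_Lipschitz[OF assms(1) y]
      by (auto intro!: continuous_intros)
    finally show "\<bar>(r y t - r y s) - (r x t - r x s)\<bar> \<le> w\<^sub>3 * (t - s) * \<bar>y - x\<bar>"
      by (simp add: mult_ac)
  qed
  show ?thesis using *[of s t] *[of t s] assms by (cases "s \<le> t") auto
qed

lemma DERIV_r_time:
  assumes "x \<in> {0..1}" "t \<in> {0<..<T}"
  shows "DERIV (r x) t :> v x t"
proof -
  have "((\<lambda>t. x + integral {0..t} (v x)) has_real_derivative 0 + v x t) (at t within {0..T})"
    using assms
    by (intro DERIV_add DERIV_const integral_has_real_derivative continuous_v_time) auto
  then show ?thesis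
    using assms by (simp add: radius_def[abs_def] at_within_Icc_at)
qed

text \<open>Differentiation under the integral sign writes \<open>r_x\<close> as a time integral of
  \<open>v_x\<close>, to which the fundamental theorem of calculus applies.\<close>

lemma DERIV_r_x_time:
  assumes x: "x \<in> {0<..<1}" and t: "t \<in> {0<..<T}"
  shows "DERIV (r_x x) t :> v_x x t"
proof -
  \<comment> \<open>A positive starting time is chosen because \<open>v_x\<close> is continuous only
    for positive times.\<close>
  define s where "s = t / 2"
  have s: "0 < s" "s < t" "t < T" using t by (auto simp: s_def)
  have inc: "r_x x \<tau> = r_x x s + integral {s..\<tau>} (v_x x)" if \<tau>: "\<tau> \<in> {s..T}" for \<tau>
  proof -
    have "((\<lambda>y. integral (cbox s \<tau>) (v y)) has_real_derivative integral (cbox s \<tau>) (v_x x))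
        (at x within {0<..<1})"
    proof (rule leibniz_rule_field_derivative)
      show "((\<lambda>y. v y t) has_real_derivative v_x z t) (at z within {0<..<1})"
        if "z \<in> {0<..<1}" "t \<in> cbox s \<tau>" for z t
        using that s \<tau> by (intro has_field_derivative_subset[OF DERIV_v_x[of z t]]) auto
      show "v z integrable_on cbox s \<tau>" if "z \<in> {0<..<1}" for z
        using that s \<tau> by (intro integrable_continuous continuous_v_time) auto
      show "continuous_on ({0<..<1} \<times> cbox s \<tau>) (\<lambda>(x, t). v_x x t)"
        using s \<tau> by (intro continuous_on_subset[OF continuous_v_x]) auto
    qed (use x in auto)
    then have D: "((\<lambda>y. integral {s..\<tau>} (v y)) has_real_derivative integral {s..\<tau>} (v_x x)) (at x)"
      using x at_within_open[of x "{0<..<1}"] by simp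
    have ev: "\<forall>\<^sub>F y in nhds x. integral {s..\<tau>} (v y) = r y \<tau> - r y s"
      using eventually_nhds_in_open[of "{0<..<1}" x] x s \<tau>
      by (auto elim!: eventually_mono simp: r_increment)
    have "((\<lambda>y. r y \<tau> - r y s) has_real_derivative integral {s..\<tau>} (v_x x)) (at x)"
      using D DERIV_cong_ev[OF refl ev refl] by blast
    moreover have "((\<lambda>y. r y \<tau> - r y s) has_real_derivative r_x x \<tau> - r_x x s) (at x)"
      using DERIV_diff[OF DERIV_r_x[of x \<tau>] DERIV_r_x[of x s]] x s \<tau>
      by (auto simp: at_within_unit_interval)
    ultimately have "r_x x \<tau> - r_x x s = integral {s..\<tau>} (v_x x)" by (rule DERIV_unique[symmetric])
    then show ?thesis by simp
  qed
  have "continuous_on {s..T} (v_x x)"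
    using x s by (intro continuous_on_slice_snd[OF continuous_v_x]) auto
  then have "((\<lambda>\<tau>. r_x x s + integral {s..\<tau>} (v_x x)) has_real_derivative 0 + v_x x t) (at t within {s..T})"
    using s by (intro DERIV_add DERIV_const integral_has_real_derivative) auto
  then have "((\<lambda>\<tau>. r_x x s + integral {s..\<tau>} (v_x x)) has_real_derivative v_x x t) (at t within {s..T})"
    by simp
  then have "(r_x x has_real_derivative v_x x t) (at t within {s..T})"
    by (rule has_field_derivative_transform_within[OF _ zero_less_one]) (use s inc in \<open>auto simp only: atLeastAtMost_iff\<close>)
  then show ?thesis using s by (simp add: at_within_Icc_at)
qed

lemma DERIV_v_time:
  assumes "x \<in> {0<..<1}" "t \<in> {0<..<T}"
  shows "DERIV (v x) t :> v_t x t"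
proof -
  have "(v x has_real_derivative v_t x t) (at t within {0..T})"
    using sol assms unfolding euler_solution_def partial_t_def
    by (simp add: has_real_derivative_iff_has_vector_derivative vector_derivative_works[symmetric])
  then show ?thesis using assms by (simp add: at_within_Icc_at)
qed

lemma continuous_r: "continuous_on ({0..1} \<times> {0..T}) (\<lambda>(x, t). r x t)"
proof (rule continuous_on_Times_Lipschitz[of _ _ _ w\<^sub>3])
  show "continuous_on {0..1} (\<lambda>x. r x t)" if "t \<in> {0..T}" for t
    using that by (intro DERIV_continuous_on[of _ _ "\<lambda>x. r_x x t"] DERIV_r_x) auto
qed (use r_Lipschitz_time w_pos in auto)

section \<open>The pressure in terms of the stretches\<close>

lemma pressure_eq:
  assumes "x \<in> {0<..<1}" "t \<in> {0..T}"
  shows "pressure \<gamma> \<rho> v x t = \<rho> x powr \<gamma> * (r x t / x) powr (- 2 * \<gamma>) * r_x x t powr (- \<gamma>)"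
proof -
  have pos: "r x t > 0" "r_x x t > 0" "\<rho> x > 0" "x > 0"
    using r_pos r_x_pos assms density by (auto simp: vacuum_density_def)
  have powr_prod: "(\<rho> x * (r x t / x) powr p * r_x x t powr q) powr \<gamma>
      = \<rho> x powr \<gamma> * (r x t / x) powr (p * \<gamma>) * r_x x t powr (q * \<gamma>)" for p q
    using pos by (simp add: powr_mult powr_powr)
  have "x\<^sup>2 / (r x t)\<^sup>2 * (\<rho> x / r_x x t) = \<rho> x * (r x t / x) powr (- 2) * r_x x t powr (- 1)"
    using pos by (simp add: powr_minus powr_numeral field_simps)
  then have "pressure \<gamma> \<rho> v x t = (\<rho> x * (r x t / x) powr (- 2) * r_x x t powr (- 1)) powr \<gamma>"
    by (simp only: pressure_def)
  also have "\<dots> = \<rho> x powr \<gamma> * (r x t / x) powr (- 2 * \<gamma>) * r_x x t powr (- 1 * \<gamma>)"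
    by (rule powr_prod)
  finally show ?thesis by simp
qed

text \<open>The momentum equation solved for the pressure gradient; the equation itself enters the
  proof only through this lemma.\<close>

lemma DERIV_pressure:
  assumes "x \<in> {0<..<1}" "t \<in> {0<..T}"
  shows "DERIV (\<lambda>y. pressure \<gamma> \<rho> v y t) x :> - \<rho> x * (x / r x t)\<^sup>2 * v_t x t"
proof -
  have "((\<lambda>y. pressure \<gamma> \<rho> v y t) has_real_derivative partial_x (pressure \<gamma> \<rho> v) x t) (at x within {0..1})"
    using sol assms by (intro has_real_derivative_partial_x) (auto simp: euler_solution_def)
  moreover have "partial_x (pressure \<gamma> \<rho> v) x t = - \<rho> x * (x / r x t)\<^sup>2 * v_t x t"
    using sol assms by (simp add: euler_solution_def eq_neg_iff_add_eq_0 add.commute)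
  ultimately show ?thesis using assms by (simp add: at_within_unit_interval)
qed

text \<open>Up to the factors \<open>- 2 * x\<close> and \<open>- 1\<close>, the left sides are the
  partial derivatives of the internal energy density in the stretches \<open>r / x\<close> and
  \<open>r_x\<close>. Written with the pressure, they can be compared with the derivative of the
  flux.\<close>

lemma pressure_work:
  assumes "x \<in> {0<..<1}" "t \<in> {0..T}"
  defines "k \<equiv> \<gamma> - 1"
  shows "\<rho> x powr \<gamma> * x * ((r x t / x) powr (- 2 * k - 1) * r_x x t powr (- k))
      = r x t * r_x x t * pressure \<gamma> \<rho> v x t"
    and "\<rho> x powr \<gamma> * x\<^sup>2 * ((r x t / x) powr (- 2 * k) * r_x x t powr (- k - 1))
      = (r x t)\<^sup>2 * pressure \<gamma> \<rho> v x t"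
proof -
  have pos: "r x t / x > 0" "r_x x t > 0" "x > 0"
    using r_pos r_x_pos assms(1,2) by auto
  have k: "- 2 * k - 1 = 1 + (- 2 * \<gamma>)" "- k = 1 + (- \<gamma>)" "- 2 * k = 2 + (- 2 * \<gamma>)" "- k - 1 = - \<gamma>"
    by (auto simp: k_def)
  have powr_shift: "y powr (1 + c) = y * y powr c" "y powr (2 + c) = y\<^sup>2 * y powr c"
    if "y > 0" for y c :: real
    using that by (simp_all add: powr_add powr_numeral)
  have *: "(r x t / x) powr (- 2 * k - 1) = r x t / x * (r x t / x) powr (- 2 * \<gamma>)"
    "r_x x t powr (- k) = r_x x t * r_x x t powr (- \<gamma>)"
    "(r x t / x) powr (- 2 * k) = (r x t / x)\<^sup>2 * (r x t / x) powr (- 2 * \<gamma>)"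
    "r_x x t powr (- k - 1) = r_x x t powr (- \<gamma>)"
    using powr_shift(1)[OF pos(1), of "- 2 * \<gamma>", folded k(1)] powr_shift(1)[OF pos(2), of "- \<gamma>", folded k(2)]
      powr_shift(2)[OF pos(1), of "- 2 * \<gamma>", folded k(3)] k(4) by simp_all
  show "\<rho> x powr \<gamma> * x * ((r x t / x) powr (- 2 * k - 1) * r_x x t powr (- k))
      = r x t * r_x x t * pressure \<gamma> \<rho> v x t"
    and "\<rho> x powr \<gamma> * x\<^sup>2 * ((r x t / x) powr (- 2 * k) * r_x x t powr (- k - 1))
      = (r x t)\<^sup>2 * pressure \<gamma> \<rho> v x t"
    unfolding * pressure_eq[OF assms(1,2)] using pos(3) by (simp_all add: power_divide)
qed

text \<open>For positive times \<open>r_x\<close> is a continuous function of the pressure, which is differentiable.\<close>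

lemma continuous_r_x: "continuous_on ({0<..<1} \<times> {0..T}) (\<lambda>(x, t). r_x x t)"
proof (rule continuous_on_Times_Lipschitz[of _ _ _ w\<^sub>3])
  fix t assume t: "t \<in> {0..T}"
  show "continuous_on {0<..<1} (\<lambda>x. r_x x t)"
  \<comment> \<open>The pressure is known to be differentiable only for \<open>t > 0\<close>; at
    \<open>t = 0\<close> the radius is the identity, so \<open>r_x\<close> is 1.\<close>
  proof (cases "t = 0")
    case True
    have "r_x x 0 = 1" if "x \<in> {0<..<1}" for x
      using that by (intro partial_x_eqI) (auto simp: radius_def intro!: derivative_eq_intros)
    then show ?thesis
      using True continuous_on_cong[of "{0<..<1}" "{0<..<1}" "\<lambda>x. r_x x 0" "\<lambda>_. 1"] by simp
  next
    case False
    let ?P = "\<lambda>x. pressure \<gamma> \<rho> v x t"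
    have pos: "r x t > 0" "r_x x t > 0" "\<rho> x > 0" "x > 0" if "x \<in> {0<..<1}" for x
      using r_pos r_x_pos that t density by (auto simp: vacuum_density_def)
    have "r_x x t = x\<^sup>2 / (r x t)\<^sup>2 * \<rho> x * ?P x powr (- 1 / \<gamma>)" if "x \<in> {0<..<1}" for x
    proof -
      have "(A powr \<gamma>) powr (- 1 / \<gamma>) = inverse A" if "A > 0" for A :: real
        using that gamma by (simp add: powr_powr powr_minus)
      from this[of "x\<^sup>2 / (r x t)\<^sup>2 * (\<rho> x / r_x x t)"]
      have "?P x powr (- 1 / \<gamma>) = inverse (x\<^sup>2 / (r x t)\<^sup>2 * (\<rho> x / r_x x t))"
        unfolding pressure_def using pos[OF that] by simp
      then show ?thesis using pos[OF that] by (simp add: field_simps)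
    qed
    moreover have "continuous_on {0<..<1} (\<lambda>x. x\<^sup>2 / (r x t)\<^sup>2 * \<rho> x * ?P x powr (- 1 / \<gamma>))"
    proof -
      have c: "continuous_on {0<..<1} (\<lambda>x. ?P x)"
        using False t by (intro continuous_at_imp_continuous_on ballI DERIV_isCont[OF DERIV_pressure]) auto
      have c': "continuous_on {0<..<1} (\<lambda>x. r x t)"
        using t by (intro continuous_on_slice_fst[OF continuous_r]) auto
      have c'': "continuous_on {0<..<1} \<rho>"
        using density by (auto simp: vacuum_density_def intro: continuous_on_subset)
      have "?P x \<noteq> 0 \<and> (r x t)\<^sup>2 \<noteq> 0" if "x \<in> {0<..<1}" for x
        using pos[OF that] by (simp add: pressure_def)
      then show ?thesis
        by (intro continuous_on_mult continuous_on_divide continuous_on_powr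
            continuous_on_power continuous_on_id continuous_on_const c c' c'') auto
    qed
    ultimately show ?thesis
      using continuous_on_cong[of "{0<..<1}" "{0<..<1}" "\<lambda>x. r_x x t"] by simp
  qed
qed (use r_x_Lipschitz_time w_pos in auto)

end

section \<open>The relative energy of two flows\<close>

text \<open>The function \<open>exp (- K * s) * (E s + \<epsilon> / K)\<close> is nonincreasing. The
  constant \<open>\<epsilon>\<close> will be the bound on the boundary fluxes, and the derivative is
  asked for only inside the time interval.\<close>

lemma Gronwall_affine:
  fixes E :: "real \<Rightarrow> real"
  assumes "K > 0" and cont: "continuous_on {0..T} E" and init: "E 0 \<le> 0"
    and der: "\<And>t. t \<in> {0<..<T} \<Longrightarrow> \<exists>E'. DERIV E t :> E' \<and> E' \<le> K * E t + \<epsilon>"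
    and t: "t \<in> {0..T}"
  shows "E t \<le> \<epsilon> / K * (exp (K * t) - 1)"
proof -
  have "(\<lambda>s. exp (- K * s) * (E s + \<epsilon> / K)) t \<le> (\<lambda>s. exp (- K * s) * (E s + \<epsilon> / K)) 0"
  proof (rule DERIV_nonpos_imp_decreasing_open[of 0 t "\<lambda>s. exp (- K * s) * (E s + \<epsilon> / K)"])
    show "continuous_on {0..t} (\<lambda>s. exp (- K * s) * (E s + \<epsilon> / K))"
      using t \<open>K > 0\<close> by (intro continuous_intros continuous_on_subset[OF cont]) auto
    fix s assume "0 < s" "s < t"
    then obtain E' where E': "DERIV E s :> E'" "E' \<le> K * E s + \<epsilon>" using der[of s] t by auto
    have "DERIV (\<lambda>s. exp (- K * s) * (E s + \<epsilon> / K)) s :> exp (- K * s) * (E' - (K * E s + \<epsilon>))"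
      using E'(1) \<open>K > 0\<close> by (auto intro!: derivative_eq_intros simp: field_simps)
    moreover have "exp (- K * s) * (E' - (K * E s + \<epsilon>)) \<le> 0"
      using E'(2) by (simp add: mult_nonneg_nonpos)
    ultimately show "\<exists>y. DERIV (\<lambda>s. exp (- K * s) * (E s + \<epsilon> / K)) s :> y \<and> y \<le> 0" by blast
  qed (use t in auto)
  then have "exp (- K * t) * (E t + \<epsilon> / K) \<le> \<epsilon> / K" using init by simp
  then have "exp (K * t) * (exp (- K * t) * (E t + \<epsilon> / K)) \<le> exp (K * t) * (\<epsilon> / K)"
    by (intro mult_left_mono) auto
  moreover have "exp (K * t) * exp (- K * t) = 1" by (simp add: exp_minus)
  ultimately have "E t + \<epsilon> / K \<le> exp (K * t) * (\<epsilon> / K)"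
    by (simp add: mult.assoc[symmetric])
  then show ?thesis by (simp add: algebra_simps)
qed

lemma continuous_on_powr_rem:
  assumes "continuous_on S a" "continuous_on S b" "continuous_on S a\<^sub>0" "continuous_on S b\<^sub>0"
    and "\<And>z. z \<in> S \<Longrightarrow> a z > 0 \<and> b z > 0 \<and> a\<^sub>0 z > 0 \<and> b\<^sub>0 z > 0"
  shows "continuous_on S (\<lambda>z. powr_rem p q (a z) (b z) (a\<^sub>0 z) (b\<^sub>0 z))"
  unfolding powr_rem_def
  by (intro continuous_intros assms) (use assms(5) in fastforce)+

text \<open>Puts time first, as differentiation of a spatial integral with respect to time
  requires.\<close>

lemma continuous_on_swap_args:
  assumes "continuous_on (A \<times> B) (\<lambda>(x, y). f x y)"
  shows "continuous_on (B \<times> A) (\<lambda>(y, x). f x y)"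
proof -
  have "continuous_on (B \<times> A) (\<lambda>z. (snd z, fst z))" by (intro continuous_intros)
  from continuous_on_compose2[OF assms this] show ?thesis
    by (auto simp: split_beta image_subset_iff)
qed

text \<open>\<open>B\<close> is the reference flow, at which the Taylor expansions are based. The
  common \<open>u\<^sub>0\<close> expresses the agreement of the initial velocities in the
  interior.\<close>

locale two_flows =
  A: bounded_flow \<gamma> T w\<^sub>1 w\<^sub>2 w\<^sub>3 \<rho> u\<^sub>0 v\<^sub>1 + B: bounded_flow \<gamma> T w\<^sub>1 w\<^sub>2 w\<^sub>3 \<rho> u\<^sub>0 v\<^sub>2
  for \<gamma> T w\<^sub>1 w\<^sub>2 w\<^sub>3 :: real and \<rho> u\<^sub>0 :: "real \<Rightarrow> real" and v\<^sub>1 v\<^sub>2 :: "real \<Rightarrow> real \<Rightarrow> real"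
begin

definition k where "k = \<gamma> - 1"

definition rem where
  "rem p q x t = powr_rem p q (A.r x t / x) (A.r_x x t) (B.r x t / x) (B.r_x x t)"

text \<open>The kinetic energy of the difference plus the relative internal energy: the Taylor remainder
  of \<open>(a\<^sup>2 b)\<^sup>-\<^sup>k / k\<close>, \<open>a = r / x\<close>, \<open>b = r_x\<close>, at the second flow.\<close>

definition energy where
  "energy x t = \<rho> x * x\<^sup>2 * (v\<^sub>1 x t - v\<^sub>2 x t)\<^sup>2 / 2 + \<rho> x powr \<gamma> * x\<^sup>2 / k * rem (- 2 * k) (- k) x t"

definition flux where
  "flux x t = (v\<^sub>1 x t - v\<^sub>2 x t) *
     ((A.r x t)\<^sup>2 * pressure \<gamma> \<rho> v\<^sub>1 x t - (B.r x t)\<^sup>2 * pressure \<gamma> \<rho> v\<^sub>2 x t)"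

text \<open>The outcome of \<open>DERIV_powr_rem\<close> with \<open>v / x\<close> and
  \<open>v_x\<close> as the rates of the two stretches. It is left in this form because the first
  two groups cancel against the flux derivative and the two \<open>rem\<close> terms are the
  source.\<close>

definition energy_t where
  "energy_t x t = \<rho> x * x\<^sup>2 * (v\<^sub>1 x t - v\<^sub>2 x t) * (A.v_t x t - B.v_t x t) + \<rho> x powr \<gamma> * x\<^sup>2 / k *
     (- 2 * k * ((A.r x t / x) powr (- 2 * k - 1) * A.r_x x t powr (- k)
          - (B.r x t / x) powr (- 2 * k - 1) * B.r_x x t powr (- k)) * (v\<^sub>1 x t / x - v\<^sub>2 x t / x)
      + (- k) * ((A.r x t / x) powr (- 2 * k) * A.r_x x t powr (- k - 1)
          - (B.r x t / x) powr (- 2 * k) * B.r_x x t powr (- k - 1)) * (A.v_x x t - B.v_x x t)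
      + (- 2 * k) * rem (- 2 * k - 1) (- k) x t * (v\<^sub>2 x t / x)
      + (- k) * rem (- 2 * k) (- k - 1) x t * B.v_x x t)"

definition dist2 where
  "dist2 x t = (A.r x t / x - B.r x t / x)\<^sup>2 + (A.r_x x t - B.r_x x t)\<^sup>2"

lemma k_pos: "k > 0"
  using A.gamma by (simp add: k_def)

lemma density_pos: "x \<in> {0<..<1} \<Longrightarrow> \<rho> x > 0"
  using A.density by (auto simp: vacuum_density_def)

lemma continuous_density: "continuous_on {0..1} \<rho>"
  using A.density by (auto simp: vacuum_density_def)

section \<open>Convexity bounds for the relative internal energy\<close>

lemma stretches_in_box:
  assumes "x \<in> {0<..<1}" "t \<in> {0..T}"
  shows "{A.r x t / x, A.r_x x t, B.r x t / x, B.r_x x t} \<subseteq> {w\<^sub>1..w\<^sub>2}"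
  using A.stretch_bounds[of x t] B.stretch_bounds[of x t] A.bounds[of x t] B.bounds[of x t] assms
  by simp

lemma stretches_pos:
  assumes "x \<in> {0<..<1}" "t \<in> {0..T}"
  shows "A.r x t / x > 0" "A.r_x x t > 0" "B.r x t / x > 0" "B.r_x x t > 0"
  using stretches_in_box[OF assms] A.w_pos by auto

lemma rem_upper:
  obtains C where "C > 0"
    "\<And>x t. x \<in> {0<..<1} \<Longrightarrow> t \<in> {0..T} \<Longrightarrow> \<bar>rem p q x t\<bar> \<le> C * dist2 x t"
  using powr_rem_upper[OF A.w_pos(1) A.w_le, of p q] stretches_in_box
  unfolding rem_def dist2_def by metis

lemma rem_lower:
  obtains c where "c > 0"
    "\<And>x t. x \<in> {0<..<1} \<Longrightarrow> t \<in> {0..T} \<Longrightarrow> c * dist2 x t \<le> rem (- 2 * k) (- k) x t"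
  using powr_rem_lower[OF A.w_pos(1) A.w_le k_pos] stretches_in_box
  unfolding rem_def dist2_def by metis

text \<open>The internal part is nonnegative by convexity, so the energy controls the weighted
  velocity difference.\<close>

lemma kinetic_le_energy:
  assumes "x \<in> {0<..<1}" "t \<in> {0..T}"
  shows "\<rho> x * x\<^sup>2 * (v\<^sub>1 x t - v\<^sub>2 x t)\<^sup>2 / 2 \<le> energy x t"
proof -
  obtain c where "c > 0" "c * dist2 x t \<le> rem (- 2 * k) (- k) x t"
    using rem_lower assms by metis
  moreover have "dist2 x t \<ge> 0" by (simp add: dist2_def)
  ultimately have "rem (- 2 * k) (- k) x t \<ge> 0"
    by (smt (verit) mult_nonneg_nonneg)
  then show ?thesis using k_pos by (simp add: energy_def)
qed

section \<open>The local balance law of the relative energy\<close>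

lemma DERIV_energy:
  assumes "x \<in> {0<..<1}" "t \<in> {0<..<T}"
  shows "DERIV (energy x) t :> energy_t x t"
proof -
  have "DERIV (rem (- 2 * k) (- k) x) t :>
      - 2 * k * ((A.r x t / x) powr (- 2 * k - 1) * A.r_x x t powr (- k)
          - (B.r x t / x) powr (- 2 * k - 1) * B.r_x x t powr (- k)) * (v\<^sub>1 x t / x - v\<^sub>2 x t / x)
      + (- k) * ((A.r x t / x) powr (- 2 * k) * A.r_x x t powr (- k - 1)
          - (B.r x t / x) powr (- 2 * k) * B.r_x x t powr (- k - 1)) * (A.v_x x t - B.v_x x t)
      + (- 2 * k) * rem (- 2 * k - 1) (- k) x t * (v\<^sub>2 x t / x)
      + (- k) * rem (- 2 * k) (- k - 1) x t * B.v_x x t"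
    unfolding rem_def[abs_def]
    using assms by (intro DERIV_powr_rem DERIV_cdivide A.DERIV_r_time B.DERIV_r_time
        A.DERIV_r_x_time B.DERIV_r_x_time stretches_pos) auto
  note D = DERIV_cmult[OF this, of "\<rho> x powr \<gamma> * x\<^sup>2 / k"]
  have "DERIV (\<lambda>t. \<rho> x * x\<^sup>2 * (v\<^sub>1 x t - v\<^sub>2 x t)\<^sup>2 / 2) t :>
      \<rho> x * x\<^sup>2 * (v\<^sub>1 x t - v\<^sub>2 x t) * (A.v_t x t - B.v_t x t)"
    using DERIV_cmult[OF DERIV_power[OF DERIV_diff[OF A.DERIV_v_time[OF assms] B.DERIV_v_time[OF assms]],
        of 2], of "\<rho> x * x\<^sup>2 / 2"] by (simp add: mult_ac)
  from DERIV_add[OF this D] show ?thesis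
    unfolding energy_def[abs_def] energy_t_def .
qed

text \<open>By the momentum equation the pressure gradients reproduce the kinetic part of
  \<open>energy_t\<close>, and by \<open>pressure_work\<close> the remaining terms reproduce its
  work terms, both with the opposite sign. Only the Taylor remainders survive.\<close>

lemma DERIV_flux:
  assumes "x \<in> {0<..<1}" "t \<in> {0<..<T}"
  shows "DERIV (\<lambda>x. flux x t) x :>
    \<rho> x powr \<gamma> * x\<^sup>2 * (- 2 * rem (- 2 * k - 1) (- k) x t * (v\<^sub>2 x t / x)
      - rem (- 2 * k) (- k - 1) x t * B.v_x x t) - energy_t x t"
proof -
  have t: "t \<in> {0..T}" "t \<in> {0<..T}" and x: "x \<in> {0..1}" using assms by auto
  have nz: "A.r x t \<noteq> 0" "B.r x t \<noteq> 0" "x \<noteq> 0"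
    using stretches_pos[OF assms(1) t(1)] assms by auto
  note D = A.DERIV_v_x[OF x t(1)] B.DERIV_v_x[OF x t(1)] A.DERIV_r_x[OF x t(1)] B.DERIV_r_x[OF x t(1)]
  note D' = D[unfolded at_within_unit_interval[OF assms(1)]]
    A.DERIV_pressure[OF assms(1) t(2)] B.DERIV_pressure[OF assms(1) t(2)]
  let ?P = "pressure \<gamma> \<rho> v\<^sub>1 x t" and ?Q = "pressure \<gamma> \<rho> v\<^sub>2 x t"
  have "DERIV (\<lambda>x. flux x t) x :>
     (A.v_x x t - B.v_x x t) * ((A.r x t)\<^sup>2 * ?P - (B.r x t)\<^sup>2 * ?Q)
     + (v\<^sub>1 x t - v\<^sub>2 x t) * ((2 * A.r x t * A.r_x x t * ?P
         + (A.r x t)\<^sup>2 * (- \<rho> x * (x / A.r x t)\<^sup>2 * A.v_t x t))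
       - (2 * B.r x t * B.r_x x t * ?Q
         + (B.r x t)\<^sup>2 * (- \<rho> x * (x / B.r x t)\<^sup>2 * B.v_t x t)))"
    unfolding flux_def[abs_def]
    by (rule derivative_eq_intros D' refl)+ (simp add: algebra_simps)
  \<comment> \<open>The square of the radius cancels the factor \<open>(x / r)\<^sup>2\<close> of
    the equation, leaving the weight of the kinetic energy.\<close>
  also have "(A.r x t)\<^sup>2 * (- \<rho> x * (x / A.r x t)\<^sup>2 * A.v_t x t) = - \<rho> x * x\<^sup>2 * A.v_t x t"
    using nz by (simp add: power_divide)
  also have "(B.r x t)\<^sup>2 * (- \<rho> x * (x / B.r x t)\<^sup>2 * B.v_t x t) = - \<rho> x * x\<^sup>2 * B.v_t x t"
    using nz by (simp add: power_divide)
  finally have *: "DERIV (\<lambda>x. flux x t) x :>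
     (A.v_x x t - B.v_x x t) * ((A.r x t)\<^sup>2 * ?P - (B.r x t)\<^sup>2 * ?Q)
     + 2 * (v\<^sub>1 x t - v\<^sub>2 x t) * (A.r x t * A.r_x x t * ?P - B.r x t * B.r_x x t * ?Q)
     - \<rho> x * x\<^sup>2 * (v\<^sub>1 x t - v\<^sub>2 x t) * (A.v_t x t - B.v_t x t)"
    by (simp add: algebra_simps)
  note pw = A.pressure_work[OF assms(1) t(1), folded k_def] B.pressure_work[OF assms(1) t(1), folded k_def]
  have energy_identity: "z + R * x\<^sup>2 / k * (- 2 * k * (X - X') * (u / x - u' / x)
      + (- k) * (Y - Y') * w + (- 2 * k) * p * (u' / x) + (- k) * q * w')
    = z - 2 * (u - u') * (R * x * X - R * x * X') - w * (R * x\<^sup>2 * Y - R * x\<^sup>2 * Y')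
      + R * x\<^sup>2 * (- 2 * p * (u' / x) - q * w')"
    if "x \<noteq> 0" "k \<noteq> 0" for x k z R X X' u u' Y Y' w p q w' :: real
    using that by (simp add: field_simps power2_eq_square)
  have e: "energy_t x t = \<rho> x * x\<^sup>2 * (v\<^sub>1 x t - v\<^sub>2 x t) * (A.v_t x t - B.v_t x t)
     - 2 * (v\<^sub>1 x t - v\<^sub>2 x t) * (A.r x t * A.r_x x t * ?P - B.r x t * B.r_x x t * ?Q)
     - (A.v_x x t - B.v_x x t) * ((A.r x t)\<^sup>2 * ?P - (B.r x t)\<^sup>2 * ?Q)
     + \<rho> x powr \<gamma> * x\<^sup>2 * (- 2 * rem (- 2 * k - 1) (- k) x t * (v\<^sub>2 x t / x)
      - rem (- 2 * k) (- k - 1) x t * B.v_x x t)"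
    using energy_identity[of x k "\<rho> x powr \<gamma>", OF nz(3)] k_pos
    unfolding energy_t_def pw[symmetric] by simp
  show ?thesis using * unfolding e by (rule DERIV_cong) simp
qed

text \<open>The energy involves only \<open>v\<close>, \<open>r\<close> and \<open>r_x\<close>,
  which are continuous down to \<open>t = 0\<close>. Its time derivative also involves
  \<open>v_x\<close> and \<open>v_t\<close>, whose continuity is given only for positive
  times.\<close>

lemma continuous_energy:
  "continuous_on ({0<..<1} \<times> {0..T}) (\<lambda>(x, t). energy x t)" (is ?th1)
  and continuous_energy_t:
  "continuous_on ({0<..<1} \<times> {0<..<T}) (\<lambda>(x, t). energy_t x t)" (is ?th2)
proof -
  have c: "continuous_on (S \<times> U) (\<lambda>z. f (fst z) (snd z))"
    if "continuous_on (S' \<times> U') (\<lambda>(x, t). f x t)" "S \<subseteq> S'" "U \<subseteq> U'"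
    for S S' U U' :: "real set" and f :: "real \<Rightarrow> real \<Rightarrow> real"
    using continuous_on_subset[OF that(1), of "S \<times> U"] that(2,3) by (auto simp: split_beta)
  have r: "continuous_on ({0<..<1} \<times> U) (\<lambda>z. \<rho> (fst z))" for U :: "real set"
    by (rule continuous_on_compose2[OF continuous_density]) (auto intro!: continuous_intros)
  have cont_rem: "continuous_on ({0<..<1} \<times> U) (\<lambda>z. rem p q (fst z) (snd z))"
    if "U \<subseteq> {0..T}" for U p q
    unfolding rem_def
    by (intro continuous_on_powr_rem continuous_on_divide c[OF A.continuous_r] c[OF B.continuous_r]
        c[OF A.continuous_r_x] c[OF B.continuous_r_x] continuous_on_fst continuous_on_id)
      (use that stretches_pos in \<open>auto simp: subset_iff\<close>)
  note cs = c[OF A.continuous_v] c[OF B.continuous_v] c[OF A.continuous_r] c[OF B.continuous_r]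
        c[OF A.continuous_r_x] c[OF B.continuous_r_x] c[OF A.continuous_v_x] c[OF B.continuous_v_x]
        c[OF A.continuous_v_t] c[OF B.continuous_v_t] r cont_rem
  show ?th1
    unfolding energy_def split_beta
    by (intro continuous_intros cs) (use density_pos k_pos in \<open>auto simp: less_le\<close>)
  have nz: "A.r_x x t \<noteq> 0" "B.r_x x t \<noteq> 0" "A.r x t \<noteq> 0" "B.r x t \<noteq> 0" "\<rho> x \<noteq> 0"
    if "x \<in> {0<..<1}" "t \<in> {0<..<T}" for x t
    using stretches_pos[of x t] density_pos[of x] that by auto
  show ?th2
    unfolding energy_t_def split_beta
    by (intro continuous_intros cs) (use k_pos in \<open>auto simp: nz\<close>)
qed

text \<open>Together with the time derivative of \<open>energy\<close> the flux derivative leaves only terms quadratic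
  in the difference of the stretches.\<close>

lemma energy_balance:
  obtains K where "K > 0" and "\<And>x t. x \<in> {0<..<1} \<Longrightarrow> t \<in> {0<..<T} \<Longrightarrow>
    \<exists>\<phi>. DERIV (\<lambda>x. flux x t) x :> \<phi> \<and> energy_t x t + \<phi> \<le> K * energy x t"
proof -
  obtain c where c: "c > 0"
    "\<And>x t. x \<in> {0<..<1} \<Longrightarrow> t \<in> {0..T} \<Longrightarrow> c * dist2 x t \<le> rem (- 2 * k) (- k) x t"
    using rem_lower by blast
  obtain C where C: "C > 0"
    "\<And>x t. x \<in> {0<..<1} \<Longrightarrow> t \<in> {0..T} \<Longrightarrow> \<bar>rem (- 2 * k - 1) (- k) x t\<bar> \<le> C * dist2 x t"
    using rem_upper by blast
  obtain C' where C': "C' > 0"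
    "\<And>x t. x \<in> {0<..<1} \<Longrightarrow> t \<in> {0..T} \<Longrightarrow> \<bar>rem (- 2 * k) (- k - 1) x t\<bar> \<le> C' * dist2 x t"
    using rem_upper by blast
  \<comment> \<open>Both \<open>v\<^sub>2 / x\<close> and the gradient of \<open>v\<^sub>2\<close>
    are at most \<open>w\<^sub>3\<close> in modulus; \<open>1 / c\<close> passes from
    \<open>dist2\<close> to the convex remainder, and \<open>k\<close> offsets the division by
    \<open>k\<close> in \<open>energy\<close>.\<close>
  define K where "K = k * w\<^sub>3 * (2 * C + C') / c"
  show thesis
  proof (rule that)
    show "K > 0" using c(1) C(1) C'(1) k_pos A.w_pos by (simp add: K_def add_pos_pos)
    fix x t :: real assume x: "x \<in> {0<..<1}" and t: "t \<in> {0<..<T}"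
    then have t': "t \<in> {0..T}" by simp
    let ?R = "\<rho> x powr \<gamma> * x\<^sup>2"
    let ?p = "rem (- 2 * k - 1) (- k) x t" and ?q = "rem (- 2 * k) (- k - 1) x t"
    have "\<bar>v\<^sub>2 x t / x\<bar> \<le> w\<^sub>3"
      using B.v_bound[of x t] x t' by (simp add: abs_divide divide_le_eq)
    then have "\<bar>?p * (v\<^sub>2 x t / x)\<bar> \<le> C * dist2 x t * w\<^sub>3"
      unfolding abs_mult using C(2)[OF x t'] by (intro mult_mono) auto
    moreover have "\<bar>?q * B.v_x x t\<bar> \<le> C' * dist2 x t * w\<^sub>3"
      unfolding abs_mult using C'(2)[OF x t'] B.bounds[of x t] x t' by (intro mult_mono) auto
    ultimately have "- 2 * ?p * (v\<^sub>2 x t / x) - ?q * B.v_x x t \<le> w\<^sub>3 * (2 * C + C') * dist2 x t"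
      unfolding abs_le_iff by (simp add: algebra_simps)
    also have "\<dots> = w\<^sub>3 * (2 * C + C') / c * (c * dist2 x t)"
      using c(1) by simp
    also have "\<dots> \<le> w\<^sub>3 * (2 * C + C') / c * rem (- 2 * k) (- k) x t"
      using c(1) C(1) C'(1) A.w_pos by (intro mult_left_mono c(2) x t') auto
    finally have "?R * (- 2 * ?p * (v\<^sub>2 x t / x) - ?q * B.v_x x t)
        \<le> ?R * (w\<^sub>3 * (2 * C + C') / c * rem (- 2 * k) (- k) x t)"
      by (rule mult_left_mono) simp
    also have "\<dots> = K * (?R / k * rem (- 2 * k) (- k) x t)"
      using k_pos by (simp add: K_def)
    also have "\<dots> \<le> K * energy x t"
      using density_pos[OF x] \<open>K > 0\<close> by (intro mult_left_mono) (auto simp: energy_def)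
    finally show "\<exists>\<phi>. DERIV (\<lambda>x. flux x t) x :> \<phi> \<and> energy_t x t + \<phi> \<le> K * energy x t"
      using DERIV_flux[OF x t] by fastforce
  qed
qed

text \<open>The velocity difference is at most \<open>2 * w\<^sub>3 * x\<close>, and each
  \<open>r\<^sup>2 P\<close> is a bounded function of the stretches times
  \<open>\<rho> powr \<gamma>\<close>.\<close>

lemma flux_bound:
  obtains D where "D > 0"
    "\<And>x t. x \<in> {0<..<1} \<Longrightarrow> t \<in> {0..T} \<Longrightarrow> \<bar>flux x t\<bar> \<le> D * (x * \<rho> x powr \<gamma>)"
proof -
  obtain l u where u: "l > 0" "\<And>a. a \<in> {w\<^sub>1..w\<^sub>2} \<Longrightarrow> l \<le> a powr (- 2 * \<gamma>) \<and> a powr (- 2 * \<gamma>) \<le> u"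
    using powr_bounds[OF A.w_pos(1) A.w_le] by blast
  obtain l' u' where u': "l' > 0" "\<And>a. a \<in> {w\<^sub>1..w\<^sub>2} \<Longrightarrow> l' \<le> a powr (- \<gamma>) \<and> a powr (- \<gamma>) \<le> u'"
    using powr_bounds[OF A.w_pos(1) A.w_le] by blast
  have pos: "u > 0" "u' > 0"
    using u(1) u(2)[of "w\<^sub>1"] u'(1) u'(2)[of "w\<^sub>1"] A.w_le by auto
  have work: "\<bar>(radius v x t)\<^sup>2 * pressure \<gamma> \<rho> v x t\<bar> \<le> w\<^sub>2\<^sup>2 * (\<rho> x powr \<gamma> * u * u')"
    if flow: "bounded_flow \<gamma> T w\<^sub>1 w\<^sub>2 w\<^sub>3 \<rho> u\<^sub>0 v" and x: "x \<in> {0<..<1}" and t: "t \<in> {0..T}" for v x t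
  proof -
    interpret bounded_flow \<gamma> T w\<^sub>1 w\<^sub>2 w\<^sub>3 \<rho> u\<^sub>0 v by (rule flow)
    have box: "r x t / x \<in> {w\<^sub>1..w\<^sub>2}" "r_x x t \<in> {w\<^sub>1..w\<^sub>2}"
      using stretch_bounds[of x t] bounds[of x t] x t by auto
    have "r x t \<le> w\<^sub>2 * x" using r_bounds[of x t] x t by simp
    also have "\<dots> \<le> w\<^sub>2" using x w_pos by simp
    finally have "(r x t)\<^sup>2 \<le> w\<^sub>2\<^sup>2" using r_pos[of x t] x t by (intro power_mono) auto
    moreover have "pressure \<gamma> \<rho> v x t \<le> \<rho> x powr \<gamma> * u * u'"
      unfolding pressure_eq[OF x t]
      using u(2)[OF box(1)] u'(2)[OF box(2)] pos by (intro mult_mono) auto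
    moreover have "pressure \<gamma> \<rho> v x t \<ge> 0" by (simp add: pressure_def)
    ultimately show ?thesis
      unfolding abs_mult by (intro mult_mono) auto
  qed
  show thesis
  proof (rule that[of "2 * w\<^sub>3 * (2 * (w\<^sub>2\<^sup>2 * u * u'))"])
    show "2 * w\<^sub>3 * (2 * (w\<^sub>2\<^sup>2 * u * u')) > 0" using A.w_pos pos by simp
    fix x t :: real assume x: "x \<in> {0<..<1}" and t: "t \<in> {0..T}"
    have "\<bar>v\<^sub>1 x t - v\<^sub>2 x t\<bar> \<le> 2 * w\<^sub>3 * x"
      using A.v_bound[of x t] B.v_bound[of x t] x t by auto
    moreover have "\<bar>(A.r x t)\<^sup>2 * pressure \<gamma> \<rho> v\<^sub>1 x t - (B.r x t)\<^sup>2 * pressure \<gamma> \<rho> v\<^sub>2 x t\<bar>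
        \<le> 2 * (w\<^sub>2\<^sup>2 * (\<rho> x powr \<gamma> * u * u'))"
      using work[OF A.bounded_flow_axioms x t] work[OF B.bounded_flow_axioms x t] by auto
    ultimately have "\<bar>flux x t\<bar> \<le> 2 * w\<^sub>3 * x * (2 * (w\<^sub>2\<^sup>2 * (\<rho> x powr \<gamma> * u * u')))"
      unfolding flux_def abs_mult using A.w_pos x by (intro mult_mono) auto
    then show "\<bar>flux x t\<bar> \<le> 2 * w\<^sub>3 * (2 * (w\<^sub>2\<^sup>2 * u * u')) * (x * \<rho> x powr \<gamma>)"
      by (simp add: mult_ac)
  qed
qed

section \<open>The integrated energy estimate and the limit of vanishing boundary flux\<close>

lemma energy_initial: "x \<in> {0<..<1} \<Longrightarrow> energy x 0 = 0"
proof -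
  assume x: "x \<in> {0<..<1}"
  \<comment> \<open>Both flows start from the identity, so their stretches coincide and the
    remainder vanishes.\<close>
  have "radius v y 0 = y" for v y by (simp add: radius_def)
  then have "A.r x 0 = B.r x 0" "A.r_x x 0 = B.r_x x 0" by (simp_all add: partial_x_def)
  moreover have "v\<^sub>1 x 0 = v\<^sub>2 x 0" using A.sol B.sol x by (simp add: euler_solution_def)
  ultimately show ?thesis by (simp add: energy_def rem_def powr_rem_def)
qed

text \<open>The time derivative of \<open>v\<close> may blow up at the centre, at the vacuum boundary and at \<open>t = 0\<close>,
  so the energy is integrated over \<open>[h, 1 - h]\<close> and the flux through the two ends is kept.\<close>

lemma energy_integral_bound:
  obtains L where "\<And>h t. h \<in> {0<..<1/2} \<Longrightarrow> t \<in> {0..T} \<Longrightarrow>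
    integral {h..1 - h} (\<lambda>x. energy x t) \<le> L * (h * \<rho> h powr \<gamma> + (1 - h) * \<rho> (1 - h) powr \<gamma>)"
proof -
  obtain K where K: "K > 0" "\<And>x t. x \<in> {0<..<1} \<Longrightarrow> t \<in> {0<..<T} \<Longrightarrow>
    \<exists>\<phi>. DERIV (\<lambda>x. flux x t) x :> \<phi> \<and> energy_t x t + \<phi> \<le> K * energy x t"
    using energy_balance by blast
  obtain D where D: "D > 0"
    "\<And>x t. x \<in> {0<..<1} \<Longrightarrow> t \<in> {0..T} \<Longrightarrow> \<bar>flux x t\<bar> \<le> D * (x * \<rho> x powr \<gamma>)"
    using flux_bound by blast
  show thesis
  proof (rule that)
    fix h t :: real assume h: "h \<in> {0<..<1/2}" and t: "t \<in> {0..T}"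
    have sub: "{h..1 - h} \<subseteq> {0<..<1}" using h by auto
    define E where "E t = integral {h..1 - h} (\<lambda>x. energy x t)" for t
    \<comment> \<open>This bounds the total flux through the two ends, uniformly in time.\<close>
    define \<epsilon> where "\<epsilon> = D * (h * \<rho> h powr \<gamma> + (1 - h) * \<rho> (1 - h) powr \<gamma>)"
    have \<epsilon>: "\<epsilon> \<ge> 0" using D(1) h by (simp add: \<epsilon>_def)
    have cont_E: "continuous_on {0..T} E"
      using integral_continuous_on_param[of "{0..T}" h "1 - h" "\<lambda>t x. energy x t"]
        continuous_on_subset[OF continuous_on_swap_args[OF continuous_energy], of "{0..T} \<times> {h..1 - h}"] sub
      unfolding E_def[abs_def] by fastforce
    have "E t \<le> \<epsilon> / K * (exp (K * t) - 1)"
    proof (rule Gronwall_affine[OF K(1) cont_E _ _ t])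
      have "E 0 = integral {h..1 - h} (\<lambda>_. 0)"
        unfolding E_def using sub by (intro integral_cong energy_initial) auto
      then show "E 0 \<le> 0" by simp
      fix t assume t: "t \<in> {0<..<T}"
      then have t': "t \<in> {0..T}" by simp
      have "((\<lambda>t. integral (cbox h (1 - h)) (\<lambda>x. energy x t)) has_real_derivative
          integral (cbox h (1 - h)) (\<lambda>x. energy_t x t)) (at t within {0<..<T})"
      proof (rule leibniz_rule_field_derivative)
        show "((\<lambda>t. energy x t) has_real_derivative energy_t x s) (at s within {0<..<T})"
          if "s \<in> {0<..<T}" "x \<in> cbox h (1 - h)" for s x
          using that sub by (intro has_field_derivative_at_within[OF DERIV_energy]) auto
        show "(\<lambda>x. energy x s) integrable_on cbox h (1 - h)" if "s \<in> {0<..<T}" for s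
          using that sub
          by (intro integrable_continuous continuous_on_slice_fst[OF continuous_energy]) auto
        show "continuous_on ({0<..<T} \<times> cbox h (1 - h)) (\<lambda>(t, x). energy_t x t)"
          using sub by (intro continuous_on_subset[OF continuous_on_swap_args[OF continuous_energy_t]]) auto
      qed (use t in auto)
      then have "DERIV E t :> integral {h..1 - h} (\<lambda>x. energy_t x t)"
        using t at_within_open[of t "{0<..<T}"] by (simp add: E_def[abs_def])
      moreover have "integral {h..1 - h} (\<lambda>x. energy_t x t) \<le> K * E t + \<epsilon>"
      proof -
        have "\<forall>x\<in>{0<..<1}. \<exists>\<phi>. DERIV (\<lambda>x. flux x t) x :> \<phi> \<and> energy_t x t + \<phi> \<le> K * energy x t"
          using K(2) t by blast
        then obtain \<phi> where \<phi>: "\<And>x. x \<in> {0<..<1} \<Longrightarrow> DERIV (\<lambda>x. flux x t) x :> \<phi> x"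
          "\<And>x. x \<in> {0<..<1} \<Longrightarrow> energy_t x t + \<phi> x \<le> K * energy x t"
          by metis
        \<comment> \<open>Continuity of the chosen \<open>\<phi>\<close> is not known; the
          fundamental theorem of calculus asks only that it be the derivative of the flux.\<close>
        have I1: "(\<phi> has_integral flux (1 - h) t - flux h t) {h..1 - h}"
          using h sub by (intro fundamental_theorem_of_calculus)
            (auto simp: has_real_derivative_iff_has_vector_derivative[symmetric]
              intro!: has_field_derivative_at_within[OF \<phi>(1)])
        have I2: "((\<lambda>x. energy_t x t) has_integral integral {h..1 - h} (\<lambda>x. energy_t x t)) {h..1 - h}"
          using sub t by (intro integrable_integral integrable_continuous_interval
              continuous_on_slice_fst[OF continuous_energy_t]) auto
        have I3: "((\<lambda>x. K * energy x t) has_integral K * E t) {h..1 - h}"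
          unfolding E_def using sub t' by (intro has_integral_mult_right integrable_integral
              integrable_continuous_interval continuous_on_slice_fst[OF continuous_energy]) auto
        have "integral {h..1 - h} (\<lambda>x. energy_t x t) + (flux (1 - h) t - flux h t) \<le> K * E t"
          using \<phi>(2) sub by (intro has_integral_le[OF has_integral_add[OF I2 I1] I3]) auto
        moreover have "\<bar>flux (1 - h) t\<bar> \<le> D * ((1 - h) * \<rho> (1 - h) powr \<gamma>)" "\<bar>flux h t\<bar> \<le> D * (h * \<rho> h powr \<gamma>)"
          using h t' by (intro D(2); simp)+
        ultimately show ?thesis by (simp add: \<epsilon>_def algebra_simps)
      qed
      ultimately show "\<exists>E'. DERIV E t :> E' \<and> E' \<le> K * E t + \<epsilon>" by blast
    qed
    \<comment> \<open>Replacing \<open>t\<close> by \<open>T\<close> makes the constant independent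
      of both \<open>t\<close> and \<open>h\<close>.\<close>
    also have "\<dots> \<le> \<epsilon> / K * exp (K * T)"
    proof -
      have "exp (K * t) \<le> exp (K * T)" using K(1) t by simp
      then have "exp (K * t) - 1 \<le> exp (K * T)" by linarith
      then show ?thesis using K(1) \<epsilon> by (intro mult_left_mono) auto
    qed
    finally show "integral {h..1 - h} (\<lambda>x. energy x t)
        \<le> D / K * exp (K * T) * (h * \<rho> h powr \<gamma> + (1 - h) * \<rho> (1 - h) powr \<gamma>)"
      by (simp add: E_def \<epsilon>_def mult_ac)
  qed
qed

text \<open>The kinetic energy on a fixed interval \<open>[c, 1 - c]\<close> is at most the energy
  on any larger \<open>[h, 1 - h]\<close>, which is bounded by the end fluxes and tends to 0 with
  \<open>h\<close>. A continuous nonnegative function with zero integral vanishes.\<close>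

lemma velocities_agree_interior:
  assumes x: "x \<in> {0<..<1}" and t: "t \<in> {0..T}"
  shows "v\<^sub>1 x t = v\<^sub>2 x t"
proof -
  obtain L where L: "\<And>h t. h \<in> {0<..<1/2} \<Longrightarrow> t \<in> {0..T} \<Longrightarrow>
    integral {h..1 - h} (\<lambda>x. energy x t) \<le> L * (h * \<rho> h powr \<gamma> + (1 - h) * \<rho> (1 - h) powr \<gamma>)"
    using energy_integral_bound by blast
  define q where "q y = \<rho> y * y\<^sup>2 * (v\<^sub>1 y t - v\<^sub>2 y t)\<^sup>2 / 2" for y
  \<comment> \<open>The interval \<open>[c, 1 - c]\<close> contains \<open>x\<close>; the cap 1/3
    keeps it nondegenerate when \<open>x = 1/2\<close>.\<close>
  define c where "c = min (min x (1 - x)) (1/3)"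
  have c: "0 < c" "c < 1/2" "x \<in> {c..1 - c}" using x by (auto simp: c_def min_def)
  have cont_q: "continuous_on {0..1} q"
    unfolding q_def using t
    by (intro continuous_intros continuous_density continuous_on_slice_fst[OF A.continuous_v]
        continuous_on_slice_fst[OF B.continuous_v]) auto
  have q_nonneg: "q y \<ge> 0" if "y \<in> {0<..<1}" for y
    using density_pos[OF that] by (simp add: q_def)
  have q_int: "q integrable_on {a..b}" if "{a..b} \<subseteq> {0..1}" for a b
    using cont_q that by (intro integrable_continuous_interval) (rule continuous_on_subset)
  define \<omega> where "\<omega> h = L * (h * \<rho> h powr \<gamma> + (1 - h) * \<rho> (1 - h) powr \<gamma>)" for h
  have "integral {c..1 - c} q \<le> \<omega> h" if h: "h \<in> {0<..<c}" for h
  proof -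
    have sub: "{h..1 - h} \<subseteq> {0<..<1}" using h c by auto
    have "integral {c..1 - c} q \<le> integral {h..1 - h} q"
      using h c sub q_nonneg by (intro integral_subset_le q_int) auto
    also have "\<dots> \<le> integral {h..1 - h} (\<lambda>x. energy x t)"
      using h c sub t kinetic_le_energy
      by (intro integral_le q_int integrable_continuous_interval
          continuous_on_slice_fst[OF continuous_energy]) (auto simp: q_def)
    also have "\<dots> \<le> \<omega> h" unfolding \<omega>_def using h c t by (intro L) auto
    finally show ?thesis .
  qed
  \<comment> \<open>The term at the centre vanishes through the factor \<open>h\<close>, the one at
    the vacuum boundary because \<rho> is continuous with \<rho>(1) = 0; no decay rate
    enters.\<close>
  moreover have "(\<omega> \<longlongrightarrow> 0) (at_right 0)"
  proof -
    have powr_cont: "continuous_on {0..1} (\<lambda>y. \<rho> y powr \<gamma>)"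
      using A.gamma A.density
      by (intro continuous_on_powr' continuous_density continuous_on_const)
        (auto simp: vacuum_density_def less_eq_real_def)
    have "continuous_on {0..1} \<omega>"
      unfolding \<omega>_def
      by (intro continuous_intros powr_cont continuous_on_compose2[OF powr_cont, of _ "\<lambda>y. 1 - y"]) auto
    then have "(\<omega> \<longlongrightarrow> \<omega> 0) (at 0 within {0..1})" by (simp add: continuous_on_def)
    moreover have "\<omega> 0 = 0" using A.density by (simp add: \<omega>_def vacuum_density_def)
    ultimately show ?thesis by (simp add: at_within_Icc_at_right)
  qed
  moreover have "\<forall>\<^sub>F h in at_right 0. h \<in> {0<..<c}"
    using c by (intro eventually_at_right_real)
  ultimately have "integral {c..1 - c} q \<le> 0"
    by (intro tendsto_lowerbound[of \<omega> 0 "at_right 0"]) (auto elim: eventually_mono)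
  moreover have "integral {c..1 - c} q \<ge> 0"
    using c q_nonneg by (intro integral_nonneg q_int) auto
  ultimately have "\<forall>y\<in>{c..1 - c}. q y = 0"
    using c q_nonneg
    by (subst integral_eq_0_iff[symmetric]) (auto intro: continuous_on_subset[OF cont_q])
  then have "q x = 0" using c by blast
  then show ?thesis using density_pos[OF x] x by (auto simp: q_def)
qed

text \<open>Continuity in \<open>x\<close> carries the equality to the centre and the vacuum
  boundary.\<close>

lemma velocities_agree:
  assumes "x \<in> {0..1}" and t: "t \<in> {0..T}"
  shows "v\<^sub>1 x t = v\<^sub>2 x t"
proof -
  have "closure {0<..<1} = {0..1::real}" by simp
  then have "continuous_on (closure {0<..<1}) (\<lambda>x. v\<^sub>1 x t - v\<^sub>2 x t)"
    using t by (auto intro!: continuous_intros continuous_on_slice_fst[OF A.continuous_v]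
        continuous_on_slice_fst[OF B.continuous_v])
  from continuous_constant_on_closure[OF this, of 0 x] show ?thesis
    using velocities_agree_interior t assms by auto
qed

end

theorem theorem11p1:
  fixes \<gamma> T w\<^sub>1 w\<^sub>2 w\<^sub>3 :: real
    and \<rho>\<^sub>0 u\<^sub>0 :: "real \<Rightarrow> real"
    and v\<^sub>1 v\<^sub>2 :: "real \<Rightarrow> real \<Rightarrow> real"
  assumes "\<gamma> > 1" and "T > 0"
    and "vacuum_density \<rho>\<^sub>0"
    and "euler_solution \<gamma> T \<rho>\<^sub>0 u\<^sub>0 v\<^sub>1"
    and "euler_solution \<gamma> T \<rho>\<^sub>0 u\<^sub>0 v\<^sub>2"
    and "w\<^sub>1 > 0" and "w\<^sub>2 > 0" and "w\<^sub>3 > 0"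
    and "\<And>v x t. v \<in> {v\<^sub>1, v\<^sub>2} \<Longrightarrow> x \<in> {0..1} \<Longrightarrow> t \<in> {0..T} \<Longrightarrow>
           w\<^sub>1 \<le> partial_x (radius v) x t \<and> partial_x (radius v) x t \<le> w\<^sub>2 \<and>
           \<bar>partial_x v x t\<bar> \<le> w\<^sub>3"
    and "\<And>x. x \<in> {0..1} \<Longrightarrow> v\<^sub>1 x 0 = v\<^sub>2 x 0"
  shows "\<forall>x\<in>{0..1}. \<forall>t\<in>{0..T}. v\<^sub>1 x t = v\<^sub>2 x t"
proof -
  interpret two_flows \<gamma> T w\<^sub>1 w\<^sub>2 w\<^sub>3 \<rho>\<^sub>0 u\<^sub>0 v\<^sub>1 v\<^sub>2
    using assms(1-9) by unfold_locales auto
  show ?thesis using velocities_agree by blast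
qed

end
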